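(* Let $G$ be a connected graph, let $n \geq 0$ be an integer, and let $\lambda$ be the minimum integer such that $\mathrm{iso}(G-S) \leq \lambda|S|$ for all $S \subseteq V(G)$ (such an integer being assumed to exist, i.e. $G$ is not a single vertex). Let $M$ be a maximum matching of $G$ with $\mathrm{nc}(M)=\mathrm{nc}(G)$, and let $D^+$ and $D^-$ be the associated sets. If $\mu_f(G) = \frac{1}{2}(|V(G)|-n)$, then $\lambda \leq \left\lceil\frac{n}{\delta(G)}\right\rceil + 1$ and $G$ has a $\{K_{1,1}, \dots, K_{1,\lambda}, C_m : m \geq 3 \}$-factor $F$ such that $l(G) = \sum_{i=1}^\lambda (i-1)t_i^F = n$. Furthermore, $F$ can be taken such that the $K_{1,j}$-components of $F$ are induced subgraphs of $G$, and for $j \geq 2$ their center vertices are in $N(D^+ \cup D^-)$, where $N(D^+\cup D^-)\subseteq A$, and their leaves are in $D^+ \cup D^-$.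
   Context: All graphs are finite and simple. $\delta(G)$ is the minimum degree. $G-S$ is the subgraph induced by $V(G)\setminus S$, and $\mathrm{iso}(H)$ is the number of isolated vertices (trivial components) of $H$. For $X\subseteq V(G)$, $N(X)=\bigcup_{x\in X}N(x)$ is the union of the neighborhoods of the vertices of $X$. Fractional matchings: a fractional matching is a function $f:E(G)\to[0,1]$ such that for every vertex $v$ the sum of $f(e)$ over edges $e$ incident to $v$ is at most $1$; $\mu_f(G)$ is the supremum of $\sum_{e\in E(G)} f(e)$ over all fractional matchings. Factors: $K_{1,i}$ is the star with $i$ edges, whose center is its vertex of degree $i$ (for $K_{1,1}$ either vertex) and whose other vertices are leaves; $C_m$ is the circuit on $m$ vertices. For a set $\mathcal S$ of connected graphs, an $\mathcal S$-factor of $G$ is a spanning subgraph each of whose components is isomorphic to a member of $\mathcal S$; a component isomorphic to $H$ is an $H$-component. A star-cycle factor is a $\{K_{1,1},\dots,K_{1,t},C_m : m\ge 3\}$-factor for some positive integer $t$. For a star-cycle factor $F$, $t_i^F$ is the number of $K_{1,i}$-components of $F$, and $l(G)=\min\{\sum_{i=1}^{\infty}(i-1)t_i^F : F \text{ a star-cycle factor of } G\}$. Gallai–Edmonds decomposition $(D,A,C)$: $D$ is the set of vertices of $G$ missed by at least one maximum matching, $A=N(D)\setminus D$, $C=V(G)\setminus(D\cup A)$. For a maximum matching $M$, $\mathrm{nc}(M)$ is the number of non-trivial components (components with more than one vertex) of $G[D]$ that are not matched by an edge of $M$ having one end in $D$ and the other in $A$; $\mathrm{nc}(G)$ is the maximum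 of $\mathrm{nc}(M)$ over all maximum matchings $M$ of $G$. Let $\mathrm{Iso}(G[D])$ be the set of isolated vertices of $G[D]$. For a maximum matching $M$ with $\mathrm{nc}(M)=\mathrm{nc}(G)$, let $D^-$ be the set of vertices of $\mathrm{Iso}(G[D])$ that are not covered by $M$, and let $D^+$ be the set of vertices $w\in \mathrm{Iso}(G[D])\setminus D^-$ for which there is an $M$-alternating path (edges alternately in $M$ and in $E(G)\setminus M$) from $w$ to some vertex of $D^-$. *)

theory Defs
  imports Complex_Main
begin

text \<open>
  Graphs carry an explicit vertex set and a set of two-element edges. Well-formedness and
  finiteness are the predicate \<open>simple_graph\<close>; there are no loops or parallel edges.
\<close>

record 'a sgraph =
  verts :: "'a set"
  edges :: "'a set set"

definition simple_graph :: "'a sgraph \<Rightarrow> bool" where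
  "simple_graph G \<longleftrightarrow> finite (verts G) \<and> (\<forall>e\<in>edges G. e \<subseteq> verts G \<and> card e = 2)"

definition nbhd :: "'a sgraph \<Rightarrow> 'a \<Rightarrow> 'a set" where
  "nbhd G v = {u \<in> verts G. {v, u} \<in> edges G}"

definition nbhd_set :: "'a sgraph \<Rightarrow> 'a set \<Rightarrow> 'a set" where
  "nbhd_set G X = (\<Union>x\<in>X. nbhd G x)"

definition degree :: "'a sgraph \<Rightarrow> 'a \<Rightarrow> nat" where
  "degree G v = card (nbhd G v)"

definition min_degree :: "'a sgraph \<Rightarrow> nat" where
  "min_degree G = Min (degree G ` verts G)"

definition induced :: "'a sgraph \<Rightarrow> 'a set \<Rightarrow> 'a sgraph" where
  "induced G X = \<lparr>verts = verts G \<inter> X, edges = {e \<in> edges G. e \<subseteq> X}\<rparr>"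

definition delete_verts :: "'a sgraph \<Rightarrow> 'a set \<Rightarrow> 'a sgraph" where
  "delete_verts G S = induced G (verts G - S)"

definition isolated :: "'a sgraph \<Rightarrow> 'a set" where
  "isolated G = {v \<in> verts G. nbhd G v = {}}"

definition iso_num :: "'a sgraph \<Rightarrow> nat" where
  "iso_num G = card (isolated G)"

definition reach :: "'a sgraph \<Rightarrow> ('a \<times> 'a) set" where
  "reach G = {(u, v). u \<in> verts G \<and> v \<in> verts G \<and> (u, v) \<in> {(x, y). {x, y} \<in> edges G}\<^sup>*}"

definition connected_graph :: "'a sgraph \<Rightarrow> bool" where
  "connected_graph G \<longleftrightarrow>
     verts G \<noteq> {} \<and> (\<forall>u\<in>verts G. \<forall>v\<in>verts G. (u, v) \<in> reach G)"

definition components :: "'a sgraph \<Rightarrow> 'a sgraph set" where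
  "components G = induced G ` (verts G // reach G)"

definition graph_iso :: "'a sgraph \<Rightarrow> 'b sgraph \<Rightarrow> bool" where
  "graph_iso G H \<longleftrightarrow>
     (\<exists>f. bij_betw f (verts G) (verts H) \<and> edges H = (\<lambda>e. f ` e) ` edges G)"


subsection \<open>Fractional matchings\<close>

definition fractional_matching :: "'a sgraph \<Rightarrow> ('a set \<Rightarrow> real) \<Rightarrow> bool" where
  "fractional_matching G f \<longleftrightarrow>
     (\<forall>e\<in>edges G. 0 \<le> f e \<and> f e \<le> 1) \<and>
     (\<forall>v\<in>verts G. (\<Sum>e\<in>{e \<in> edges G. v \<in> e}. f e) \<le> 1)"

definition fractional_matching_number :: "'a sgraph \<Rightarrow> real" where
  "fractional_matching_number G = Sup {(\<Sum>e\<in>edges G. f e) | f. fractional_matching G f}"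


subsection \<open>Factors\<close>

definition star :: "nat \<Rightarrow> nat sgraph" where
  "star i = \<lparr>verts = {0..i}, edges = {{0, k} | k. 1 \<le> k \<and> k \<le> i}\<rparr>"

definition circuit :: "nat \<Rightarrow> nat sgraph" where
  "circuit m = \<lparr>verts = {0..<m}, edges = {{k, Suc k mod m} | k. k < m}\<rparr>"

definition is_factor :: "nat sgraph set \<Rightarrow> 'a sgraph \<Rightarrow> 'a sgraph \<Rightarrow> bool" where
  "is_factor \<S> G F \<longleftrightarrow>
     verts F = verts G \<and> edges F \<subseteq> edges G \<and>
     (\<forall>K\<in>components F. \<exists>H\<in>\<S>. graph_iso K H)"

definition stars_circuits :: "int \<Rightarrow> nat sgraph set" where
  "stars_circuits t = {star i | i. 1 \<le> i \<and> int i \<le> t} \<union> {circuit m | m. 3 \<le> m}"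

definition star_cycle_factor :: "'a sgraph \<Rightarrow> 'a sgraph \<Rightarrow> bool" where
  "star_cycle_factor G F \<longleftrightarrow> (\<exists>t\<ge>1. is_factor (stars_circuits t) G F)"

definition star_components :: "'a sgraph \<Rightarrow> nat \<Rightarrow> 'a sgraph set" where
  "star_components F i = {K \<in> components F. graph_iso K (star i)}"

definition star_count :: "'a sgraph \<Rightarrow> nat \<Rightarrow> nat" where
  "star_count F i = card (star_components F i)"

text \<open>
  The series is \<open>\<Sum>\<close> over \<open>i \<ge> 1\<close> of \<open>(i - 1) * star_count F i\<close>, shifted by one; only
  finitely many terms are nonzero when the graph is finite. The value of \<open>l_number G\<close> is
  only meaningful when \<open>G\<close> has a star-cycle factor.
\<close>

definition l_number :: "'a sgraph \<Rightarrow> nat" where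
  "l_number G =
     (LEAST k. \<exists>F. star_cycle_factor G F \<and> k = (\<Sum>i. i * star_count F (Suc i)))"

text \<open>For \<open>j = 1\<close> both vertices qualify; for \<open>j \<ge> 2\<close> the center is unique.\<close>

definition is_center :: "'a sgraph \<Rightarrow> nat \<Rightarrow> 'a \<Rightarrow> bool" where
  "is_center K j c \<longleftrightarrow> c \<in> verts K \<and> degree K c = j"


subsection \<open>Matchings and the Gallai--Edmonds decomposition\<close>

definition matching :: "'a sgraph \<Rightarrow> 'a set set \<Rightarrow> bool" where
  "matching G M \<longleftrightarrow> M \<subseteq> edges G \<and> (\<forall>e\<in>M. \<forall>e'\<in>M. e \<noteq> e' \<longrightarrow> e \<inter> e' = {})"

definition maximum_matching :: "'a sgraph \<Rightarrow> 'a set set \<Rightarrow> bool" where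
  "maximum_matching G M \<longleftrightarrow> matching G M \<and> (\<forall>M'. matching G M' \<longrightarrow> card M' \<le> card M)"

definition GE_D :: "'a sgraph \<Rightarrow> 'a set" where
  "GE_D G = {v \<in> verts G. \<exists>M. maximum_matching G M \<and> v \<notin> \<Union>M}"

definition GE_A :: "'a sgraph \<Rightarrow> 'a set" where
  "GE_A G = nbhd_set G (GE_D G) - GE_D G"

definition nc_matching :: "'a sgraph \<Rightarrow> 'a set set \<Rightarrow> nat" where
  "nc_matching G M =
     card {K \<in> components (induced G (GE_D G)).
             card (verts K) > 1 \<and> \<not> (\<exists>x\<in>verts K. \<exists>a\<in>GE_A G. {x, a} \<in> M)}"

definition nc :: "'a sgraph \<Rightarrow> nat" where
  "nc G = Max {nc_matching G M | M. maximum_matching G M}"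

text \<open>A path is given by the list of its vertices, which are pairwise distinct.\<close>

definition alternating_path :: "'a sgraph \<Rightarrow> 'a set set \<Rightarrow> 'a \<Rightarrow> 'a list \<Rightarrow> 'a \<Rightarrow> bool" where
  "alternating_path G M u p v \<longleftrightarrow>
     p \<noteq> [] \<and> hd p = u \<and> last p = v \<and> distinct p \<and> set p \<subseteq> verts G \<and>
     (\<forall>i. Suc i < length p \<longrightarrow> {p ! i, p ! Suc i} \<in> edges G) \<and>
     (\<forall>i. Suc (Suc i) < length p \<longrightarrow>
        ({p ! i, p ! Suc i} \<in> M \<longleftrightarrow> {p ! Suc i, p ! Suc (Suc i)} \<notin> M))"

definition D_minus :: "'a sgraph \<Rightarrow> 'a set set \<Rightarrow> 'a set" where
  "D_minus G M = {v \<in> isolated (induced G (GE_D G)). v \<notin> \<Union>M}"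

definition D_plus :: "'a sgraph \<Rightarrow> 'a set set \<Rightarrow> 'a set" where
  "D_plus G M =
     {w \<in> isolated (induced G (GE_D G)) - D_minus G M.
        \<exists>u\<in>D_minus G M. \<exists>p. alternating_path G M w p u}"

end

theory Submission
  imports Defs "HOL-Combinatorics.Orbits"
begin

text \<open>
  Let \<open>R\<close> be the set of vertices reached from \<open>D_minus G M\<close> by alternating paths through isolated
  vertices of \<open>G[D]\<close> and their neighbours, and let \<open>A = N(R)\<close>. Maximality of \<open>nc\<close> forces the
  \<open>M\<close>-partner of every vertex of \<open>A\<close> to lie in \<open>R\<close>, so \<open>|R| = |A| + |D_minus G M|\<close>. An exchange
  argument shows that \<open>V - R - A\<close> satisfies Hall's condition for its own neighbourhoods, hence is
  covered by disjoint edges and circuits, namely the cycles of a permutation. Comparing the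
  resulting fractional matching with the bound coming from the isolated vertices of \<open>G - A\<close> gives
  \<open>n = |D_minus G M|\<close>. Finally \<open>R\<close> is distributed over \<open>A\<close> by Hall's theorem with capacities
  \<open>\<lambda>\<close>, which yields stars of total excess \<open>|R| - |A| = n\<close>, and counting \<open>R\<close> and \<open>A\<close>
  componentwise shows that no star-cycle factor has smaller excess.
\<close>

section \<open>Hall's theorem\<close>

text \<open>One pair \<open>R\<close>, \<open>A\<close> serves twice: since \<open>R\<close> is
  independent with all neighbours in \<open>A\<close>, the difference \<open>card R - card A\<close>
  bounds from below both the deficiency of every fractional matching and the excess of every
  star-cycle factor. Equality then depends on covering the other vertices without loss, although
  \<open>M\<close> may leave non-trivial components of \<open>G[D]\<close> unmatched. These need no
  structural analysis: Hall's condition inside the rest gives a permutation moving each vertex along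
  an edge, and its odd cycles supply what a matching cannot.

  The search is confined to isolated vertices of \<open>G[D]\<close> because such lists alternate
  between D and its complement, so a return to an old vertex only shortens the search. The danger is
  a matching edge leading into a non-trivial component; the choice of \<open>M\<close> with maximal
  \<open>nc\<close> excludes exactly this, because a component of \<open>G[D]\<close> with a missed
  vertex sends no matching edge out of D.\<close>

lemma hall_marriage:
  fixes N :: "'a \<Rightarrow> 'b set"
  assumes "finite X" and "\<And>x. x \<in> X \<Longrightarrow> finite (N x)"
    and "\<And>Y. Y \<subseteq> X \<Longrightarrow> card Y \<le> card (\<Union>(N ` Y))"
  shows "\<exists>f. inj_on f X \<and> (\<forall>x\<in>X. f x \<in> N x)"
  using assms
proof (induction X arbitrary: N rule: finite_psubset_induct)
  case (psubset X)
  note fin = psubset.prems(1) and hall = psubset.prems(2)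
  have finU: "finite (\<Union>(N ` Y))" if "Y \<subseteq> X" for Y
    using that fin psubset.hyps finite_subset by (metis finite_UN subsetD)
  consider "X = {}" | Y where "Y \<noteq> {}" "Y \<subset> X" "card Y = card (\<Union>(N ` Y))"
    | "X \<noteq> {}" "\<And>Y. Y \<noteq> {} \<Longrightarrow> Y \<subset> X \<Longrightarrow> card Y < card (\<Union>(N ` Y))"
    using hall by (metis le_neq_implies_less psubset_imp_subset)
  then show ?case
  proof cases
    case 1
    then show ?thesis by simp
  next
    case 2
    have finY: "finite Y" using 2 psubset.hyps finite_subset by blast
    obtain f where f: "inj_on f Y" "\<forall>x\<in>Y. f x \<in> N x"
      using psubset.IH[OF 2(2), of N] fin hall 2(2) by (metis psubset_imp_subset subset_trans subsetD)
    \<comment> \<open>Tightness of \<open>Y\<close> lets its neighbours be discarded: in Hall's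
      inequality for \<open>Z \<union> Y\<close> the contribution of \<open>Y\<close> cancels
      exactly, leaving the inequality for \<open>Z\<close> with the reduced sets.\<close>
    define N' where "N' x = N x - \<Union>(N ` Y)" for x
    have "\<exists>g. inj_on g (X - Y) \<and> (\<forall>x\<in>X - Y. g x \<in> N' x)"
    proof (rule psubset.IH)
      show "X - Y \<subset> X" using 2 by blast
      show "finite (N' x)" if "x \<in> X - Y" for x using fin that N'_def by auto
      fix Z assume Z: "Z \<subseteq> X - Y"
      have "card Z + card Y = card (Z \<union> Y)"
        using Z finY psubset.hyps by (metis Diff_disjoint Int_commute card_Un_disjoint
            disjoint_iff finite_Diff finite_subset subsetD)
      also have "\<dots> \<le> card (\<Union>(N ` (Z \<union> Y)))" using hall[of "Z \<union> Y"] Z 2 by blast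
      also have "\<Union>(N ` (Z \<union> Y)) = \<Union>(N' ` Z) \<union> \<Union>(N ` Y)" unfolding N'_def by auto
      also have "card \<dots> \<le> card (\<Union>(N' ` Z)) + card (\<Union>(N ` Y))" by (rule card_Un_le)
      finally show "card Z \<le> card (\<Union>(N' ` Z))" using 2 by simp
    qed
    then obtain g where g: "inj_on g (X - Y)" "\<forall>x\<in>X - Y. g x \<in> N' x" by blast
    define h where "h x = (if x \<in> Y then f x else g x)" for x
    have "h x \<noteq> h y" if "x \<in> Y" "y \<in> X - Y" for x y
      using f g that unfolding h_def N'_def by auto
    then have "inj_on h X"
      using f(1) g(1) unfolding inj_on_def h_def by (metis DiffI)
    moreover have "\<forall>x\<in>X. h x \<in> N x" using f g unfolding h_def N'_def by auto
    ultimately show ?thesis by blast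
  next
    case 3
    then obtain x where x: "x \<in> X" by blast
    \<comment> \<open>No non-empty proper subset is tight, so each has a neighbour to spare, and any
      choice of \<open>y\<close> for \<open>x\<close> preserves Hall's condition on the
      rest.\<close>
    have "N x \<noteq> {}" using hall[of "{x}"] x by auto
    then obtain y where y: "y \<in> N x" by blast
    have "\<exists>g. inj_on g (X - {x}) \<and> (\<forall>z\<in>X - {x}. g z \<in> N z - {y})"
    proof (rule psubset.IH)
      show "X - {x} \<subset> X" using x by blast
      show "finite (N z - {y})" if "z \<in> X - {x}" for z using fin that by auto
      fix Z assume Z: "Z \<subseteq> X - {x}"
      show "card Z \<le> card (\<Union>z\<in>Z. N z - {y})"
      proof (cases "Z = {}")
        case False
        then have "card Z < card (\<Union>(N ` Z))" using 3(2)[of Z] Z x by blast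
        also have "\<dots> \<le> card (\<Union>(N ` Z) - {y}) + 1"
          using finU[of Z] Z by (auto simp: card_Diff_singleton_if)
        also have "\<Union>(N ` Z) - {y} = (\<Union>z\<in>Z. N z - {y})" by auto
        finally show ?thesis by simp
      qed simp
    qed
    then obtain g where g: "inj_on g (X - {x})" "\<forall>z\<in>X - {x}. g z \<in> N z - {y}" by blast
    have "inj_on (g(x := y)) X"
      using g unfolding inj_on_def by auto
    moreover have "\<forall>z\<in>X. (g(x := y)) z \<in> N z" using g y by auto
    ultimately show ?thesis by blast
  qed
qed

section \<open>Maximum matchings and Gallai's lemma\<close>

lemma finite_edges: "simple_graph G \<Longrightarrow> finite (edges G)"
  unfolding simple_graph_def by (meson PowI finite_Pow_iff finite_subset subsetI)

lemma edge_ends: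
  assumes "simple_graph G" "{u, v} \<in> edges G"
  shows "u \<in> verts G" "v \<in> verts G" "u \<noteq> v"
  using assms unfolding simple_graph_def by (auto dest!: bspec)

lemma edgeE:
  assumes "simple_graph G" "e \<in> edges G" "v \<in> e"
  obtains u where "e = {v, u}" "u \<noteq> v"
  using assms unfolding simple_graph_def by (metis card_2_iff insert_commute insert_iff singletonD)

lemma mem_nbhd: "simple_graph G \<Longrightarrow> u \<in> nbhd G v \<longleftrightarrow> {v, u} \<in> edges G"
  unfolding nbhd_def using edge_ends by fastforce

lemma matching_eqI:
  "matching G M \<Longrightarrow> e \<in> M \<Longrightarrow> e' \<in> M \<Longrightarrow> v \<in> e \<Longrightarrow> v \<in> e' \<Longrightarrow> e = e'"
  unfolding matching_def by blast

lemma matching_remove_missed: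
  assumes "matching G M" "e \<in> M" "v \<in> e"
  shows "v \<notin> \<Union>(M - {e})"
proof
  assume "v \<in> \<Union>(M - {e})"
  then obtain e' where "e' \<in> M" "e' \<noteq> e" "v \<in> e'" by blast
  then show False using matching_eqI[OF assms(1) _ assms(2) _ assms(3)] by blast
qed

lemma matching_partner_unique:
  assumes "matching G M" "{u, v} \<in> M" "{u, w} \<in> M"
  shows "v = w"
  using matching_eqI[OF assms, of u] by (auto simp: doubleton_eq_iff)

lemma matching_mono: "matching G M \<Longrightarrow> N \<subseteq> M \<Longrightarrow> matching G N"
  unfolding matching_def by blast

lemma matching_insert:
  "matching G M \<Longrightarrow> {u, v} \<in> edges G \<Longrightarrow> u \<notin> \<Union>M \<Longrightarrow> v \<notin> \<Union>M \<Longrightarrow> matching G (insert {u, v} M)"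
  unfolding matching_def by auto

lemma finite_matching: "simple_graph G \<Longrightarrow> matching G M \<Longrightarrow> finite M"
  using finite_edges finite_subset unfolding matching_def by metis

lemma maximum_matchingD: "maximum_matching G M \<Longrightarrow> matching G M"
  unfolding maximum_matching_def by blast

lemma maximum_matchingI:
  "maximum_matching G M \<Longrightarrow> matching G N \<Longrightarrow> card M \<le> card N \<Longrightarrow> maximum_matching G N"
  unfolding maximum_matching_def by force

lemma maximum_matching_card_eq:
  "maximum_matching G M \<Longrightarrow> maximum_matching G N \<Longrightarrow> card M = card N"
  unfolding maximum_matching_def by (meson order_antisym)

lemma maximum_matching_no_augment:
  assumes G: "simple_graph G" and M: "maximum_matching G M"
    and uv: "{u, v} \<in> edges G" "u \<notin> \<Union>M" "v \<notin> \<Union>M"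
  shows False
proof -
  have "matching G (insert {u, v} M)"
    using matching_insert[OF maximum_matchingD[OF M]] uv by simp
  moreover have "{u, v} \<notin> M" using uv by auto
  ultimately show False
    using M finite_matching[OF G, of M] unfolding maximum_matching_def by force
qed

lemma maximum_matching_exchange:
  assumes G: "simple_graph G" and M: "maximum_matching G M"
    and "{u, v} \<in> edges G" "u \<notin> \<Union>M" "{v, w} \<in> M"
  shows "maximum_matching G (insert {u, v} (M - {{v, w}}))"
    and "w \<notin> \<Union>(insert {u, v} (M - {{v, w}}))"
proof -
  note m = maximum_matchingD[OF M]
  have fin: "finite M" using finite_matching[OF G m] .
  have vw: "v \<noteq> w" using edge_ends(3)[OF G] assms(5) m unfolding matching_def by blast
  have out: "v \<notin> \<Union>(M - {{v, w}})" "w \<notin> \<Union>(M - {{v, w}})"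
    using matching_remove_missed[OF m assms(5)] by simp_all
  have "matching G (M - {{v, w}})" using matching_mono[OF m] by blast
  then have "matching G (insert {u, v} (M - {{v, w}}))"
    using assms(3,4) out by (intro matching_insert) auto
  moreover have "{u, v} \<notin> M - {{v, w}}" using assms(4) by blast
  then have "card (insert {u, v} (M - {{v, w}})) = card M"
    using fin assms(5) by (simp add: card_Suc_Diff1 del: card_Diff_insert)
  ultimately show "maximum_matching G (insert {u, v} (M - {{v, w}}))"
    using maximum_matchingI[OF M] by simp
  have "w \<noteq> u" using assms(4,5) by blast
  then show "w \<notin> \<Union>(insert {u, v} (M - {{v, w}}))" using out(2) vw by simp
qed

section \<open>Components of the union of two matchings\<close>

lemma card_connected_le:
  fixes E :: "'a set set"
  assumes "finite E" and C: "C = {u. (v, u) \<in> {(x, y). {x, y} \<in> E}\<^sup>*}" and "finite C"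
  shows "card C \<le> card {e \<in> E. e \<subseteq> C} + 1"
proof -
  \<comment> \<open>\<open>P\<close> asks for at least as many edges as a tree on \<open>X\<close>
    has. A maximal such \<open>X\<close> absorbs every neighbour, since the joining edge pays for
    the new vertex, and is therefore all of \<open>C\<close>.\<close>
  define P where "P X \<longleftrightarrow> v \<in> X \<and> X \<subseteq> C \<and> card X \<le> card {e \<in> E. e \<subseteq> X} + 1" for X
  have v: "v \<in> C" using C by simp
  have "finite {X. P X}" by (rule finite_subset[of _ "Pow C"]) (auto simp: P_def \<open>finite C\<close>)
  moreover have "P {v}" unfolding P_def using v by simp
  ultimately obtain X where X: "P X" and max: "\<And>Y. P Y \<Longrightarrow> X \<subseteq> Y \<Longrightarrow> X = Y"
    using finite_has_maximal[of "{X. P X}"] by blast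
  have finX: "finite X" using X \<open>finite C\<close> finite_subset unfolding P_def by blast
  have closed: "y \<in> X" if "x \<in> X" "{x, y} \<in> E" for x y
  proof (rule ccontr)
    assume y: "y \<notin> X"
    have "y \<in> C" using that X C unfolding P_def by (auto intro: rtrancl_into_rtrancl)
    have "insert {x, y} {e \<in> E. e \<subseteq> X} \<subseteq> {e \<in> E. e \<subseteq> insert y X}" using that by auto
    then have "card (insert {x, y} {e \<in> E. e \<subseteq> X}) \<le> card {e \<in> E. e \<subseteq> insert y X}"
      using \<open>finite E\<close> by (intro card_mono) auto
    moreover have "{x, y} \<notin> {e \<in> E. e \<subseteq> X}" using y by auto
    ultimately have "P (insert y X)"
      using X y \<open>y \<in> C\<close> finX \<open>finite E\<close> unfolding P_def by simp
    then show False using max y by blast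
  qed
  have "u \<in> X" if "(v, u) \<in> {(x, y). {x, y} \<in> E}\<^sup>*" for u
    using that by induction (use X closed in \<open>auto simp: P_def\<close>)
  then have "X = C" using X C unfolding P_def by blast
  then show ?thesis using X unfolding P_def by blast
qed

lemma card_covered:
  assumes G: "simple_graph G" and M: "matching G M"
    and closed: "\<And>e. e \<in> M \<Longrightarrow> e \<subseteq> C \<or> e \<inter> C = {}"
  shows "card {u \<in> C. u \<in> \<Union>M} = 2 * card {e \<in> M. e \<subseteq> C}"
proof -
  have two: "card e = 2" if "e \<in> M" for e
    using G M that unfolding simple_graph_def matching_def by blast
  have "{u \<in> C. u \<in> \<Union>M} = \<Union>{e \<in> M. e \<subseteq> C}" using closed by blast
  also have "card \<dots> = (\<Sum>e\<in>{e \<in> M. e \<subseteq> C}. card e)"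
    using M two by (intro card_Union_disjoint)
      (auto simp: pairwise_def disjnt_def matching_def intro: card_ge_0_finite)
  also have "\<dots> = 2 * card {e \<in> M. e \<subseteq> C}" using two by simp
  finally show ?thesis .
qed

text \<open>When no edge of \<open>M\<close> or \<open>N\<close> crosses the boundary of
  \<open>C\<close>, the two matchings can be recombined along it. The cardinalities are compared
  additively to avoid subtraction of natural numbers.\<close>

lemma matching_swap:
  assumes G: "simple_graph G" and M: "matching G M" and N: "matching G N"
    and closed: "\<And>e. e \<in> M \<union> N \<Longrightarrow> e \<subseteq> C \<or> e \<inter> C = {}"
  defines "M' \<equiv> {e \<in> M. e \<inter> C = {}} \<union> {e \<in> N. e \<subseteq> C}"
  shows "matching G M'"
    and "card M' + card {e \<in> M. e \<subseteq> C} = card M + card {e \<in> N. e \<subseteq> C}"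
    and "u \<notin> C \<Longrightarrow> u \<in> \<Union>M' \<longleftrightarrow> u \<in> \<Union>M"
    and "u \<in> C \<Longrightarrow> u \<in> \<Union>M' \<longleftrightarrow> u \<in> \<Union>N"
proof -
  have "M' \<subseteq> edges G" using M N unfolding M'_def matching_def by blast
  moreover have "e \<inter> e' = {}" if e: "e \<in> M'" "e' \<in> M'" "e \<noteq> e'" for e e'
  proof -
    consider "e \<in> M" "e' \<in> M" | "e \<in> N" "e' \<in> N" | "e \<inter> C = {}" "e' \<subseteq> C" | "e' \<inter> C = {}" "e \<subseteq> C"
      using e(1,2) unfolding M'_def by blast
    then show ?thesis
    proof cases
      case 1
      then show ?thesis using M e(3) unfolding matching_def by blast
    next
      case 2
      then show ?thesis using N e(3) unfolding matching_def by blast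
    qed blast+
  qed
  ultimately show "matching G M'" unfolding matching_def by blast
  have ne: "e \<noteq> {}" if "e \<in> M \<union> N" for e
    using G M N that unfolding simple_graph_def matching_def by force
  have "card M' = card {e \<in> M. e \<inter> C = {}} + card {e \<in> N. e \<subseteq> C}"
    unfolding M'_def using finite_matching[OF G] M N ne by (intro card_Un_disjoint) auto
  moreover have "card M = card {e \<in> M. e \<inter> C = {}} + card {e \<in> M. e \<subseteq> C}"
  proof -
    have "M = {e \<in> M. e \<inter> C = {}} \<union> {e \<in> M. e \<subseteq> C}" using closed by blast
    moreover have "{e \<in> M. e \<inter> C = {}} \<inter> {e \<in> M. e \<subseteq> C} = {}" using ne by blast
    ultimately show ?thesis
      using finite_matching[OF G M] by (metis (no_types, lifting) card_Un_disjoint finite_Un)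
  qed
  ultimately show "card M' + card {e \<in> M. e \<subseteq> C} = card M + card {e \<in> N. e \<subseteq> C}" by simp
  show "u \<notin> C \<Longrightarrow> u \<in> \<Union>M' \<longleftrightarrow> u \<in> \<Union>M" unfolding M'_def using closed by blast
  show "u \<in> C \<Longrightarrow> u \<in> \<Union>M' \<longleftrightarrow> u \<in> \<Union>N" unfolding M'_def using closed by blast
qed

text \<open>Inside \<open>C\<close>, twice the number of edges of a matching is
  \<open>card C\<close> minus the number of missed vertices. Adding this for \<open>M\<close> and
  \<open>N\<close> and comparing with the \<open>card C - 1\<close> edges that connectedness
  requires gives the bound 2, without describing the component as a path or a circuit.\<close>

lemma matching_union_component:
  assumes G: "simple_graph G" and M: "matching G M" and N: "matching G N" and v: "v \<in> verts G"
  obtains C where "v \<in> C" "finite C" "\<forall>e\<in>M \<union> N. e \<subseteq> C \<or> e \<inter> C = {}"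
    "card {u \<in> C. u \<notin> \<Union>M} + card {u \<in> C. u \<notin> \<Union>N} \<le> 2"
proof
  define r where "r = {(x, y). {x, y} \<in> M \<union> N}"
  define C where "C = {u. (v, u) \<in> r\<^sup>*}"
  have sub: "M \<union> N \<subseteq> edges G" using M N unfolding matching_def by blast
  show "v \<in> C" unfolding C_def by simp
  have "u \<in> verts G" if "(v, u) \<in> r\<^sup>*" for u
    using that by induction (use v sub edge_ends[OF G] in \<open>auto simp: r_def\<close>)
  then show fin: "finite C"
    using G finite_subset unfolding C_def simple_graph_def by (metis mem_Collect_eq subsetI)
  have closed: "e \<subseteq> C \<or> e \<inter> C = {}" if e: "e \<in> M \<union> N" for e
  proof -
    have "w \<in> C" if "u \<in> e" "u \<in> C" "w \<in> e" for u w
    proof -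
      obtain u' where "e = {u, u'}" using edgeE[OF G _ \<open>u \<in> e\<close>] e sub by blast
      then have "w = u \<or> (u, w) \<in> r" using e \<open>w \<in> e\<close> unfolding r_def by auto
      then show ?thesis using \<open>u \<in> C\<close> unfolding C_def by (auto intro: rtrancl_into_rtrancl)
    qed
    then show ?thesis by blast
  qed
  then show "\<forall>e\<in>M \<union> N. e \<subseteq> C \<or> e \<inter> C = {}" by blast
  have split: "card C = card {u \<in> C. u \<in> \<Union>L} + card {u \<in> C. u \<notin> \<Union>L}" for L
    using fin by (subst card_Un_disjoint[symmetric]) (auto intro: arg_cong[where f = card])
  have "card C \<le> card {e \<in> M \<union> N. e \<subseteq> C} + 1"
    using card_connected_le[of "M \<union> N" C v] fin finite_matching[OF G] M N
    unfolding C_def r_def by simp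
  also have "{e \<in> M \<union> N. e \<subseteq> C} = {e \<in> M. e \<subseteq> C} \<union> {e \<in> N. e \<subseteq> C}" by blast
  also have "card \<dots> \<le> card {e \<in> M. e \<subseteq> C} + card {e \<in> N. e \<subseteq> C}" by (rule card_Un_le)
  finally show "card {u \<in> C. u \<notin> \<Union>M} + card {u \<in> C. u \<notin> \<Union>N} \<le> 2"
    using split[of M] split[of N] card_covered[OF G M, of C] card_covered[OF G N, of C] closed
    by auto
qed

text \<open>In the component of \<open>v\<close> in \<open>M \<union> N\<close>, the matching
  \<open>N\<close> already misses \<open>v\<close>, so \<open>M\<close> misses at most one vertex
  there and \<open>x\<close> or \<open>y\<close> lies outside. Using \<open>N\<close> on this
  component and \<open>M\<close> elsewhere uncovers \<open>v\<close> and keeps that outside vertex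
  missed.\<close>

lemma maximum_matching_transfer_missed:
  assumes G: "simple_graph G" and M: "maximum_matching G M" and N: "maximum_matching G N"
    and v: "v \<in> verts G" "v \<notin> \<Union>N" and xy: "x \<noteq> y" "x \<notin> \<Union>M" "y \<notin> \<Union>M"
  obtains M' where "maximum_matching G M'" "v \<notin> \<Union>M'" "x \<notin> \<Union>M' \<or> y \<notin> \<Union>M'"
proof -
  note m = maximum_matchingD[OF M] and n = maximum_matchingD[OF N]
  obtain C where C: "v \<in> C" "finite C" "\<forall>e\<in>M \<union> N. e \<subseteq> C \<or> e \<inter> C = {}"
    "card {u \<in> C. u \<notin> \<Union>M} + card {u \<in> C. u \<notin> \<Union>N} \<le> 2"
    using matching_union_component[OF G m n v(1)] by blast
  have C3: "e \<subseteq> C \<or> e \<inter> C = {}" if "e \<in> M \<union> N" for e using C(3) that by blast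
  have C': "\<And>e. e \<in> N \<union> M \<Longrightarrow> e \<subseteq> C \<or> e \<inter> C = {}" using C(3) by blast
  define M' where "M' = {e \<in> M. e \<inter> C = {}} \<union> {e \<in> N. e \<subseteq> C}"
  note sw = matching_swap[OF G m n C3, folded M'_def]
  note sw' = matching_swap(1,2)[OF G n m C']
  \<comment> \<open>Swapping in either direction yields a matching, so neither of two maximum
    matchings has more edges inside \<open>C\<close>.\<close>
  have eq: "card {e \<in> M. e \<subseteq> C} = card {e \<in> N. e \<subseteq> C}"
  proof -
    have "card M' \<le> card M" using sw(1) M unfolding maximum_matching_def by blast
    moreover have "card ({e \<in> N. e \<inter> C = {}} \<union> {e \<in> M. e \<subseteq> C}) \<le> card N"
      using sw'(1) N unfolding maximum_matching_def by blast
    ultimately show ?thesis using sw(2) sw'(2) by linarith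
  qed
  then have max: "maximum_matching G M'"
    using maximum_matchingI[OF M sw(1)] sw(2) by simp
  have "card {u \<in> C. u \<notin> \<Union>N} \<ge> 1"
    using C(1,2) v(2) by (auto simp: Suc_le_eq card_gt_0_iff)
  then have one: "card {u \<in> C. u \<notin> \<Union>M} \<le> 1" using C(4) by simp
  have "x \<notin> C \<or> y \<notin> C"
  proof (rule ccontr)
    assume "\<not> ?thesis"
    then have "{x, y} \<subseteq> {u \<in> C. u \<notin> \<Union>M}" using xy by blast
    then have "card {x, y} \<le> card {u \<in> C. u \<notin> \<Union>M}" using C(2) by (intro card_mono) auto
    then show False using one xy by simp
  qed
  then have "x \<notin> \<Union>M' \<or> y \<notin> \<Union>M'" using sw(3) xy by blast
  moreover have "v \<notin> \<Union>M'" using sw(4) C(1) v(2) by blast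
  ultimately show thesis using that max by blast
qed

text \<open>Being missed together by no maximum matching is transitive on \<open>GE_D G\<close>, which gives
  Gallai's lemma without a minimal-distance argument.\<close>

lemma gallai:
  assumes G: "simple_graph G" and D: "D \<subseteq> GE_D G" and M: "maximum_matching G M"
    and path: "(x, y) \<in> {(u, w). {u, w} \<in> edges G \<and> u \<in> D \<and> w \<in> D}\<^sup>*"
    and xy: "x \<noteq> y" "x \<notin> \<Union>M" "y \<notin> \<Union>M"
  shows False
proof -
  define Q where "Q u w \<longleftrightarrow> u = w \<or> \<not> (\<exists>N. maximum_matching G N \<and> u \<notin> \<Union>N \<and> w \<notin> \<Union>N)" for u w
  have trans: "Q u w" if "Q u t" "Q t w" "t \<in> GE_D G" for u t w
  proof (rule ccontr)
    assume "\<not> Q u w"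
    then obtain N where N: "u \<noteq> w" "maximum_matching G N" "u \<notin> \<Union>N" "w \<notin> \<Union>N"
      unfolding Q_def by blast
    obtain L where L: "maximum_matching G L" "t \<notin> \<Union>L" "t \<in> verts G"
      using \<open>t \<in> GE_D G\<close> unfolding GE_D_def by blast
    obtain N' where "maximum_matching G N'" "t \<notin> \<Union>N'" "u \<notin> \<Union>N' \<or> w \<notin> \<Union>N'"
      using maximum_matching_transfer_missed[OF G N(2) L(1,3,2) N(1,3,4)] .
    then show False using that N unfolding Q_def by metis
  qed
  from path have "Q x y"
  proof induction
    case base
    show ?case unfolding Q_def by simp
  next
    case (step u w)
    then have "Q u w" using maximum_matching_no_augment[OF G] unfolding Q_def by blast
    then show ?case using trans step D by blast
  qed
  then show False using xy M unfolding Q_def by blast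
qed

lemma simple_induced: "simple_graph G \<Longrightarrow> simple_graph (induced G X)"
  unfolding simple_graph_def induced_def by auto

lemma simple_delete_verts: "simple_graph G \<Longrightarrow> simple_graph (delete_verts G S)"
  unfolding delete_verts_def by (rule simple_induced)

text \<open>Every maximum matching covers a vertex \<open>a\<close> outside \<open>GE_D G\<close>,
  and dropping its edge at \<open>a\<close> leaves a maximum matching of \<open>G - a\<close>. Hence
  \<open>GE_D G\<close> stays inside the corresponding set of \<open>G - a\<close>. There
  \<open>M\<close> without \<open>{y, a}\<close> misses both ends of the path, against Gallai's
  lemma, which is stated for subsets of \<open>GE_D\<close> for this purpose.\<close>

lemma no_matching_edge_between_missed_component_and_outside_D:
  assumes G: "simple_graph G" and M: "maximum_matching G M"
    and a: "a \<notin> GE_D G" "{y, a} \<in> M" and x: "x \<notin> \<Union>M"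
    and path: "(x, y) \<in> {(u, w). {u, w} \<in> edges G \<and> u \<in> GE_D G \<and> w \<in> GE_D G}\<^sup>*"
  shows False
proof -
  define H where "H = delete_verts G {a}"
  have H: "simple_graph H" using simple_delete_verts[OF G] unfolding H_def .
  have edgesH: "edges H = {e \<in> edges G. a \<notin> e}"
    using G unfolding H_def delete_verts_def induced_def simple_graph_def by auto
  have vertsH: "verts H = verts G - {a}"
    unfolding H_def delete_verts_def induced_def by auto
  have av: "a \<in> verts G"
    using edge_ends(2)[OF G] a(2) maximum_matchingD[OF M] unfolding matching_def by blast
  have matchingH: "matching H N \<longleftrightarrow> matching G N \<and> a \<notin> \<Union>N" for N
    unfolding matching_def edgesH by auto
  have small: "card N < card M" if N: "matching H N" for N
  proof (rule ccontr)
    assume "\<not> ?thesis"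
    moreover have "matching G N" using N matchingH by simp
    ultimately have "maximum_matching G N" using maximum_matchingI[OF M] by simp
    moreover have "a \<notin> \<Union>N" using N matchingH by simp
    ultimately show False using a(1) av unfolding GE_D_def by blast
  qed
  have restrict: "maximum_matching H (N - {{b, a}})"
    if N: "maximum_matching G N" "{b, a} \<in> N" for N b
  proof -
    note n = maximum_matchingD[OF N(1)]
    have "matching G (N - {{b, a}})" using n unfolding matching_def by blast
    moreover have "a \<notin> \<Union>(N - {{b, a}})" using matching_eqI[OF n _ N(2)] by blast
    ultimately have mH: "matching H (N - {{b, a}})" by (simp only: matchingH simp_thms)
    have "Suc (card (N - {{b, a}})) = card N"
      using finite_matching[OF G n] N(2) by (simp add: card_Suc_Diff1 del: card_Diff_insert)
    moreover have "card N = card M" using maximum_matching_card_eq[OF N(1) M] .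
    ultimately show ?thesis using mH small unfolding maximum_matching_def
      by (metis less_Suc_eq_le)
  qed
  have D: "GE_D G \<subseteq> GE_D H"
  proof
    fix v assume "v \<in> GE_D G"
    then obtain N where N: "v \<in> verts G" "maximum_matching G N" "v \<notin> \<Union>N"
      unfolding GE_D_def by blast
    have "a \<in> \<Union>N" using a(1) av N(2) unfolding GE_D_def by blast
    then obtain b where "{b, a} \<in> N"
      using edgeE[OF G] maximum_matchingD[OF N(2)] unfolding matching_def
      by (metis UnionE insert_commute subsetD)
    then have "maximum_matching H (N - {{b, a}})" using restrict N(2) by blast
    moreover have "v \<in> verts H" using N(1) \<open>v \<in> GE_D G\<close> a(1) vertsH by auto
    ultimately show "v \<in> GE_D H" using N(3) unfolding GE_D_def by blast
  qed
  have path': "(x, y) \<in> {(u, w). {u, w} \<in> edges H \<and> u \<in> GE_D G \<and> w \<in> GE_D G}\<^sup>*"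
    using path by (rule rtrancl_mono[THEN subsetD, rotated]) (use a(1) edgesH in auto)
  show False
  proof (rule gallai[OF H D restrict[OF M a(2)] path'])
    show "x \<noteq> y" using x a(2) by blast
    show "x \<notin> \<Union>(M - {{y, a}})" using x by blast
    show "y \<notin> \<Union>(M - {{y, a}})"
      using matching_remove_missed[OF maximum_matchingD[OF M] a(2)] by simp
  qed
qed

section \<open>Components and alternating lists\<close>

lemma equiv_reach: "equiv (verts H) (reach H)"
proof (rule equivI)
  show "reach H \<subseteq> verts H \<times> verts H" unfolding reach_def by auto
  show "refl_on (verts H) (reach H)" unfolding refl_on_def reach_def by auto
  have "sym {(x, y). {x, y} \<in> edges H}" by (auto simp: sym_def insert_commute)
  then show "sym (reach H)" using sym_rtrancl unfolding reach_def sym_def by blast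
  show "trans (reach H)" unfolding reach_def trans_def by (auto intro: rtrancl_trans)
qed

lemma verts_induced_class: "verts (induced H (reach H `` {v})) = reach H `` {v}"
  unfolding induced_def reach_def by auto

lemma componentsE:
  assumes "K \<in> components H" "v \<in> verts K"
  shows "v \<in> verts H" "K = induced H (reach H `` {v})" "verts K = reach H `` {v}"
proof -
  obtain u where u: "u \<in> verts H" "K = induced H (reach H `` {u})"
    using assms(1) unfolding components_def quotient_def by blast
  then have uv: "(u, v) \<in> reach H" using assms(2) verts_induced_class by fastforce
  then show "v \<in> verts H" unfolding reach_def by auto
  show "K = induced H (reach H `` {v})" using u equiv_class_eq[OF equiv_reach uv] by simp
  then show "verts K = reach H `` {v}" using verts_induced_class by simp
qed

lemma component_of:
  assumes "v \<in> verts H"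
  shows "induced H (reach H `` {v}) \<in> components H" "v \<in> reach H `` {v}"
  using assms unfolding components_def quotient_def reach_def by auto

lemma component_nonempty: "K \<in> components H \<Longrightarrow> \<exists>v. v \<in> verts K"
  unfolding components_def quotient_def using component_of(2) verts_induced_class by fastforce

lemma finite_components: "finite (verts H) \<Longrightarrow> finite (components H)"
  unfolding components_def using finite_quotient[OF _ equiv_type[OF equiv_reach]] by blast

lemma GE_D_subset: "GE_D G \<subseteq> verts G"
  unfolding GE_D_def by blast

lemma isolated_GE_D_iff:
  assumes "simple_graph G"
  shows "v \<in> isolated (induced G (GE_D G)) \<longleftrightarrow>
    v \<in> GE_D G \<and> (\<forall>u. {v, u} \<in> edges G \<longrightarrow> u \<notin> GE_D G)"
  unfolding isolated_def induced_def nbhd_def using GE_D_subset[of G] edge_ends[OF assms] by auto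

lemma isolated_component:
  assumes H: "simple_graph H" and v: "v \<in> isolated H" and K: "K \<in> components H" "v \<in> verts K"
  shows "verts K = {v}"
proof -
  have no: "{v, w} \<notin> edges H" for w
    using v mem_nbhd[OF H, of w v] unfolding isolated_def by simp
  have "u = v" if "(v, u) \<in> {(x, y). {x, y} \<in> edges H}\<^sup>*" for u
    using that by induction (use no in auto)
  then have "reach H `` {v} \<subseteq> {v}" unfolding reach_def by blast
  then show ?thesis using componentsE(3)[OF K] K(2) by blast
qed

text \<open>Lists grow at the head, so they read as the paths from \<open>w\<close> to
  \<open>D_minus G M\<close> that \<open>D_plus\<close> asks for. The vertices \<open>a\<close> lie
  outside D, being adjacent to isolated vertices of \<open>G[D]\<close>; \<open>a\<close> and
  \<open>x\<close> have to be new so that the matching can be switched along the list.\<close>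

inductive alternating_list :: "'a sgraph \<Rightarrow> 'a set set \<Rightarrow> 'a list \<Rightarrow> bool" for G M where
  base: "u \<in> D_minus G M \<Longrightarrow> alternating_list G M [u]"
| step: "alternating_list G M (d # p) \<Longrightarrow> {d, a} \<in> edges G \<Longrightarrow> {a, x} \<in> M \<Longrightarrow>
    a \<notin> set (d # p) \<Longrightarrow> x \<notin> set (d # p) \<Longrightarrow> x \<in> isolated (induced G (GE_D G)) \<Longrightarrow>
    alternating_list G M (x # a # d # p)"

lemma alternating_list_hd:
  "alternating_list G M p \<Longrightarrow> hd p \<in> isolated (induced G (GE_D G))"
  by (induction rule: alternating_list.induct) (auto simp: D_minus_def)

text \<open>The second conjunct strengthens the induction: alternation at \<open>d\<close> requires
  the edge that follows \<open>d\<close> in the old list to be in \<open>M\<close>.\<close>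

lemma alternating_list_path:
  assumes G: "simple_graph G" and M: "matching G M" and "alternating_list G M p"
  shows "(\<exists>u\<in>D_minus G M. alternating_path G M (hd p) p u) \<and>
    (Suc 0 < length p \<longrightarrow> {p ! 0, p ! Suc 0} \<in> M)"
  using assms(3)
proof (induction rule: alternating_list.induct)
  case (base u)
  moreover have "u \<in> verts G"
    using base GE_D_subset unfolding D_minus_def isolated_def induced_def by auto
  ultimately show ?case unfolding alternating_path_def by auto
next
  case (step d p a x)
  then obtain u where u: "u \<in> D_minus G M" "alternating_path G M d (d # p) u" by auto
  have edge: "{a, x} \<in> edges G" using M step.hyps(3) unfolding matching_def by blast
  note ends = edge_ends[OF G edge] edge_ends[OF G step.hyps(2)]
  have adM: "{a, d} \<notin> M"
    using matching_partner_unique[OF M step.hyps(3), of d] step.hyps(5) by auto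
  have "alternating_path G M x (x # a # d # p) u"
    unfolding alternating_path_def
  proof (intro conjI allI impI)
    show "distinct (x # a # d # p)"
      using u(2) step.hyps(4,5) ends unfolding alternating_path_def by auto
    show "set (x # a # d # p) \<subseteq> verts G"
      using u(2) ends unfolding alternating_path_def by auto
    show "last (x # a # d # p) = u" using u(2) unfolding alternating_path_def by simp
    show "{(x # a # d # p) ! i, (x # a # d # p) ! Suc i} \<in> edges G"
      if "Suc i < length (x # a # d # p)" for i
    proof -
      consider "i = 0" | "i = 1" | k where "i = Suc (Suc k)" by (metis One_nat_def not0_implies_Suc)
      then show ?thesis
        by cases (use that u(2) edge step.hyps(2) in \<open>auto simp: alternating_path_def insert_commute\<close>)
    qed
    show "({(x # a # d # p) ! i, (x # a # d # p) ! Suc i} \<in> M) =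
        ({(x # a # d # p) ! Suc i, (x # a # d # p) ! Suc (Suc i)} \<notin> M)"
      if "Suc (Suc i) < length (x # a # d # p)" for i
    proof -
      consider "i = 0" | "i = 1" | k where "i = Suc (Suc k)" by (metis One_nat_def not0_implies_Suc)
      then show ?thesis
        by cases (use that u(2) adM step.hyps(3) step.IH in
            \<open>auto simp: alternating_path_def insert_commute\<close>)
    qed
  qed simp_all
  then show ?case using u(1) step.hyps(3) by (auto simp: insert_commute)
qed

lemma alternating_list_hd_mem:
  assumes "simple_graph G" "matching G M" "alternating_list G M (w # p)"
  shows "w \<in> D_plus G M \<union> D_minus G M"
  using alternating_list_path[OF assms] alternating_list_hd[OF assms(3)]
  unfolding D_plus_def by auto

text \<open>One exchange per step moves the missed vertex to the new head. The clauses on edges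
  record that \<open>N\<close> differs from \<open>M\<close> only inside the list, which makes the
  components counted by \<open>nc_matching\<close> comparable before and after the switch.\<close>

lemma alternating_list_switch:
  assumes G: "simple_graph G" and M: "maximum_matching G M" and "alternating_list G M p"
  shows "\<exists>N. maximum_matching G N \<and> hd p \<notin> \<Union>N \<and>
    (\<forall>e\<in>N. e \<subseteq> set p \<or> e \<in> M \<and> e \<inter> set p = {}) \<and> (\<forall>e\<in>M. e \<inter> set p = {} \<longrightarrow> e \<in> N)"
  using assms(3)
proof (induction rule: alternating_list.induct)
  case (base u)
  then show ?case using M unfolding D_minus_def by auto
next
  case (step d p a x)
  then obtain N where N: "maximum_matching G N" "d \<notin> \<Union>N"
    "\<forall>e\<in>N. e \<subseteq> set (d # p) \<or> e \<in> M \<and> e \<inter> set (d # p) = {}"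
    "\<forall>e\<in>M. e \<inter> set (d # p) = {} \<longrightarrow> e \<in> N" by auto
  have ax: "{a, x} \<in> N" using N(4)[rule_format, OF step.hyps(3)] step.hyps(4,5) by force
  define N' where "N' = insert {d, a} (N - {{a, x}})"
  have max: "maximum_matching G N'" "x \<notin> \<Union>N'"
    using maximum_matching_exchange[OF G N(1) step.hyps(2) N(2) ax] unfolding N'_def by simp_all
  have out: "e \<inter> {a, x} = {}" if "e \<in> M" "e \<noteq> {a, x}" for e
    using matching_remove_missed[OF maximum_matchingD[OF M] step.hyps(3)] that by blast
  have "e \<subseteq> set (x # a # d # p) \<or> e \<in> M \<and> e \<inter> set (x # a # d # p) = {}" if "e \<in> N'" for e
  proof (cases "e = {d, a}")
    case False
    then have e: "e \<in> N" "e \<noteq> {a, x}" using that unfolding N'_def by auto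
    then show ?thesis using N(3) out[of e] by auto
  qed auto
  moreover have "e \<in> N'" if "e \<in> M" "e \<inter> set (x # a # d # p) = {}" for e
    using that N(4) unfolding N'_def by auto
  ultimately show ?case using max by (intro exI[of _ N']) auto
qed

text \<open>A list can be cut at every vertex except the connecting vertices \<open>a\<close>, and
  these lie outside \<open>GE_D G\<close>. So a search that returns to its own list can restart from
  there.\<close>

lemma alternating_list_suffix:
  assumes G: "simple_graph G" and "alternating_list G M p" and "y \<in> set p" "y \<in> GE_D G"
  shows "\<exists>q. alternating_list G M (y # q)"
  using assms(2-4)
proof (induction rule: alternating_list.induct)
  case (base u)
  then show ?case using alternating_list.base[OF base.hyps] by auto
next
  case (step d p a x)
  have "a \<notin> GE_D G"
    using alternating_list_hd[OF step.hyps(1)] step.hyps(2) isolated_GE_D_iff[OF G] by auto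
  then show ?case using alternating_list.step[OF step.hyps] step.IH step.prems by auto
qed

lemma alternating_list_partner:
  assumes "alternating_list G M p" and "y \<in> set p" "y \<notin> GE_D G"
  shows "\<exists>x\<in>set p. {y, x} \<in> M \<and> x \<in> GE_D G"
  using assms
proof (induction rule: alternating_list.induct)
  case (base u)
  then show ?case unfolding D_minus_def isolated_def induced_def by auto
next
  case (step d p a x)
  then show ?case unfolding isolated_def induced_def by auto
qed

lemma nc_matching_le:
  assumes G: "simple_graph G" and "maximum_matching G M"
  shows "nc_matching G M \<le> nc G"
proof -
  have "{nc_matching G M | M. maximum_matching G M} \<subseteq> nc_matching G ` Pow (edges G)"
    unfolding maximum_matching_def matching_def by auto
  then have "finite {nc_matching G M | M. maximum_matching G M}"
    using finite_edges[OF G] finite_subset by blast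
  then show ?thesis unfolding nc_def using assms(2) by (intro Max_ge) auto
qed

text \<open>Otherwise switching along the list and on to the partner would leave one more non-trivial
  component of \<open>G[D]\<close> unmatched to \<open>A\<close>.\<close>

lemma alternating_list_extend:
  assumes G: "simple_graph G" and M: "maximum_matching G M" and nc: "nc_matching G M = nc G"
    and p: "alternating_list G M (d # p)" and da: "{d, a} \<in> edges G"
  shows "\<exists>x q. {a, x} \<in> M \<and> alternating_list G M (x # q)"
proof (cases "a \<in> set (d # p)")
  case a_in: True
  \<comment> \<open>An old \<open>a\<close> is matched within the list to a vertex of
    \<open>GE_D G\<close>; cutting the list at that vertex gives the required one.\<close>
  have "a \<notin> GE_D G"
    using alternating_list_hd[OF p] da isolated_GE_D_iff[OF G] by auto
  then show ?thesis
    using alternating_list_partner[OF p a_in] alternating_list_suffix[OF G p] by blast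
next
  case a_out: False
  define D where "D = GE_D G"
  define H where "H = induced G D"
  have d: "d \<in> isolated H" using alternating_list_hd[OF p] unfolding H_def D_def by simp
  then have dD: "d \<in> D" and aD: "a \<notin> D"
    using da isolated_GE_D_iff[OF G] unfolding H_def D_def by auto
  have aA: "a \<in> GE_A G"
    using dD aD da mem_nbhd[OF G] unfolding GE_A_def nbhd_set_def D_def by auto
  obtain N where N: "maximum_matching G N" "d \<notin> \<Union>N"
    "\<forall>e\<in>N. e \<subseteq> set (d # p) \<or> e \<in> M \<and> e \<inter> set (d # p) = {}"
    using alternating_list_switch[OF G M p] by auto
  \<comment> \<open>\<open>N\<close> misses \<open>d\<close>, so it must cover \<open>a\<close>. As
    \<open>a\<close> is off the list, its edge in \<open>N\<close> belongs to \<open>M\<close> and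
    is disjoint from the list.\<close>
  have "a \<in> \<Union>N" using maximum_matching_no_augment[OF G N(1) da N(2)] by blast
  then obtain e where e: "e \<in> N" "a \<in> e" by blast
  have "e \<in> edges G" using e maximum_matchingD[OF N(1)] unfolding matching_def by blast
  then obtain x where x: "e = {a, x}" using edgeE[OF G _ e(2)] by blast
  have axN: "{a, x} \<in> N" and axM: "{a, x} \<in> M" and x_out: "x \<notin> set (d # p)"
    using N(3) e a_out unfolding x by auto
  define N' where "N' = insert {d, a} (N - {{a, x}})"
  have N': "maximum_matching G N'" "x \<notin> \<Union>N'"
    using maximum_matching_exchange[OF G N(1) da N(2) axN] unfolding N'_def by simp_all
  have xD: "x \<in> D"
    using N' edge_ends(2)[OF G] \<open>e \<in> edges G\<close> x unfolding D_def GE_D_def by blast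
  have "x \<in> isolated H"
  proof (rule ccontr)
    assume not_iso: "x \<notin> isolated H"
    define unm where "unm L = {K \<in> components H.
      card (verts K) > 1 \<and> \<not> (\<exists>y\<in>verts K. \<exists>b\<in>GE_A G. {y, b} \<in> L)}" for L
    have nc_unm: "nc_matching G L = card (unm L)" for L
      unfolding nc_matching_def unm_def H_def D_def ..
    have vertsH: "verts H = D" unfolding H_def induced_def D_def using GE_D_subset[of G] by auto
    have finH: "finite (verts H)"
      using G finite_subset[OF GE_D_subset] unfolding vertsH D_def simple_graph_def by blast
    define K where "K = induced H (reach H `` {x})"
    have K: "K \<in> components H" "x \<in> verts K"
      using component_of[of x H] xD vertsH verts_induced_class[of H x] unfolding K_def by auto
    obtain w where w: "{x, w} \<in> edges G" "w \<in> D"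
      using not_iso xD isolated_GE_D_iff[OF G, of x] unfolding H_def D_def by auto
    then have "{x, w} \<in> edges H" unfolding H_def induced_def using xD by auto
    then have "(x, w) \<in> reach H" using xD w(2) vertsH unfolding reach_def by auto
    then have "{x, w} \<subseteq> verts K" using componentsE(3)[OF K] K(2) by auto
    moreover have "finite (verts K)" using finH unfolding K_def induced_def by simp
    ultimately have "card {x, w} \<le> card (verts K)" by (intro card_mono)
    then have K2: "card (verts K) > 1" using edge_ends(3)[OF G w(1)] by simp
    have "{x, a} \<in> M" using axM by (simp add: insert_commute)
    then have "K \<notin> unm M" using aA K(2) unfolding unm_def by blast
    \<comment> \<open>\<open>N'\<close> misses \<open>x\<close>, which forbids any edge of
      \<open>N'\<close> from the component of \<open>x\<close> to the complement of D, whereas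
      \<open>M\<close> contains \<open>{x, a}\<close>.\<close>
    have "K \<in> unm N'"
    proof -
      have False if "y \<in> verts K" "b \<in> GE_A G" "{y, b} \<in> N'" for y b
      proof (rule no_matching_edge_between_missed_component_and_outside_D[OF G N'(1) _ that(3) N'(2)])
        show "b \<notin> GE_D G" using that(2) unfolding GE_A_def by blast
        have "(x, y) \<in> {(x, y). {x, y} \<in> edges H}\<^sup>*"
          using that(1) componentsE(3)[OF K] unfolding reach_def by auto
        then show "(x, y) \<in> {(u, w). {u, w} \<in> edges G \<and> u \<in> GE_D G \<and> w \<in> GE_D G}\<^sup>*"
          by (rule rtrancl_mono[THEN subsetD, rotated]) (auto simp: H_def induced_def D_def)
      qed
      then show ?thesis using K(1) K2 unfolding unm_def by blast
    qed
    \<comment> \<open>No component is lost: an edge of \<open>N'\<close> leading from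
      \<open>L\<close> into \<open>GE_A G\<close> cannot be in \<open>M\<close>, so its end in
      \<open>L\<close> is on the list. That end would be isolated in \<open>G[D]\<close>, but
      \<open>L\<close> is non-trivial.\<close>
    moreover have "unm M \<subseteq> unm N'"
    proof
      fix L assume L: "L \<in> unm M"
      have "{y, b} \<notin> N'" if y: "y \<in> verts L" and b: "b \<in> GE_A G" for y b
      proof
        assume yb: "{y, b} \<in> N'"
        have LH: "L \<in> components H" "card (verts L) > 1" using L unfolding unm_def by auto
        have "y \<in> D" using componentsE(1)[OF LH(1) y] vertsH by simp
        have "b \<notin> D" using b unfolding GE_A_def D_def by blast
        have "y \<in> set (d # p)"
          using yb N(3) L y b \<open>b \<notin> D\<close> dD \<open>y \<in> D\<close> aD unfolding N'_def unm_def
          by (auto simp: doubleton_eq_iff)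
        then obtain q where "alternating_list G M (y # q)"
          using alternating_list_suffix[OF G p] \<open>y \<in> D\<close> unfolding D_def by blast
        then have "y \<in> isolated H"
          using alternating_list_hd unfolding H_def D_def by fastforce
        then show False using isolated_component[OF simple_induced[OF G] _ LH(1)[unfolded H_def] y] LH(2) unfolding H_def by simp
      qed
      then show "L \<in> unm N'" using L unfolding unm_def by blast
    qed
    moreover have "finite (unm N')" using finite_components[OF finH] unfolding unm_def by simp
    ultimately have "card (unm M) < card (unm N')"
      using \<open>K \<notin> unm M\<close> by (intro psubset_card_mono) auto
    then show False using nc_matching_le[OF G N'(1)] nc nc_unm by simp
  qed
  then have "alternating_list G M (x # a # d # p)"
    using alternating_list.step[OF p da axM a_out x_out] unfolding H_def D_def by blast
  then show ?thesis using axM by blast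
qed

section \<open>Hall's condition off the alternating part\<close>

text \<open>These four facts are all that later arguments know about the search. The inclusion in
  \<open>D_plus G M \<union> D_minus G M\<close> eventually locates leaves and centers, and the last
  clause lets \<open>M\<close> pair the neighbours of \<open>R\<close> with vertices of
  \<open>R\<close>.\<close>

lemma alternating_closure:
  assumes G: "simple_graph G" and M: "maximum_matching G M" and nc: "nc_matching G M = nc G"
  obtains R where "D_minus G M \<subseteq> R" "R \<subseteq> D_plus G M \<union> D_minus G M"
    "R \<subseteq> isolated (induced G (GE_D G))"
    "\<forall>d a. d \<in> R \<longrightarrow> {d, a} \<in> edges G \<longrightarrow> (\<exists>x\<in>R. {a, x} \<in> M)"
proof
  define R where "R = {w. \<exists>q. alternating_list G M (w # q)}"
  show "D_minus G M \<subseteq> R" unfolding R_def by (auto intro: alternating_list.base)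
  show "R \<subseteq> D_plus G M \<union> D_minus G M"
    unfolding R_def using alternating_list_hd_mem[OF G maximum_matchingD[OF M]] by blast
  show "R \<subseteq> isolated (induced G (GE_D G))"
    unfolding R_def using alternating_list_hd by fastforce
  show "\<forall>d a. d \<in> R \<longrightarrow> {d, a} \<in> edges G \<longrightarrow> (\<exists>x\<in>R. {a, x} \<in> M)"
    unfolding R_def using alternating_list_extend[OF G M nc] by blast
qed

section \<open>Barriers and the exclusion of Hall violators\<close>

definition partner :: "'a set set \<Rightarrow> 'a \<Rightarrow> 'a" where
  "partner M v = (SOME u. {v, u} \<in> M)"

lemma partner_eqI: "matching G M \<Longrightarrow> {v, u} \<in> M \<Longrightarrow> partner M v = u"
  unfolding partner_def using matching_partner_unique by (metis someI)

lemma partner_edge: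
  assumes G: "simple_graph G" and M: "matching G M" and "v \<in> \<Union>M"
  shows "{v, partner M v} \<in> M"
proof -
  obtain e where e: "e \<in> M" "v \<in> e" using assms(3) by blast
  then have "e \<in> edges G" using M unfolding matching_def by blast
  then obtain u where "e = {v, u}" using edgeE[OF G _ e(2)] by blast
  then show ?thesis using e(1) partner_eqI[OF M] by metis
qed

text \<open>Replacing the edges of a maximum matching that meet \<open>B\<close> by the edges \<open>{b, \<phi> b}\<close> cannot lose
  edges, because all edges at \<open>J\<close> meet \<open>B\<close>.\<close>

lemma barrier:
  assumes G: "simple_graph G" and J: "\<forall>u w. u \<in> J \<longrightarrow> {u, w} \<in> edges G \<longrightarrow> w \<in> B"
    and BJ: "B \<inter> J = {}" and phi: "inj_on \<phi> B" "\<forall>b\<in>B. \<phi> b \<in> J \<and> {b, \<phi> b} \<in> edges G"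
    and M: "maximum_matching G M"
  shows "B \<subseteq> \<Union>M"
    and "maximum_matching G ({e \<in> M. e \<inter> B = {}} \<union> (\<lambda>b. {b, \<phi> b}) ` B)"
proof -
  note m = maximum_matchingD[OF M]
  define M0 where "M0 = {e \<in> M. e \<inter> B = {}}"
  define W where "W = M0 \<union> (\<lambda>b. {b, \<phi> b}) ` B"
  have Mfin: "finite M" and ME: "M \<subseteq> edges G" using finite_matching[OF G m] m unfolding matching_def by auto
  have "B \<subseteq> verts G" using phi(2) edge_ends(1)[OF G] by blast
  then have finB: "finite B" using G finite_subset unfolding simple_graph_def by blast
  have inj: "inj_on (\<lambda>b. {b, \<phi> b}) B"
    using BJ phi(2) unfolding inj_on_def by (metis disjoint_iff doubleton_eq_iff)
  have M0J: "e \<inter> J = {}" if "e \<in> M0" for e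
  proof (rule ccontr)
    assume "e \<inter> J \<noteq> {}"
    then obtain u where u: "u \<in> e" "u \<in> J" by blast
    have "e \<in> edges G" using that ME unfolding M0_def by blast
    then obtain w where "e = {u, w}" using edgeE[OF G _ u(1)] by blast
    then show False using J u(2) \<open>e \<in> edges G\<close> that unfolding M0_def by blast
  qed
  have "W \<subseteq> edges G" using ME phi(2) unfolding W_def M0_def by auto
  moreover have "e \<inter> e' = {}" if e: "e \<in> W" "e' \<in> W" "e \<noteq> e'" for e e'
  proof -
    have star: "f \<inter> {b, \<phi> b} = {}" if "f \<in> M0" "b \<in> B" for f b
      using M0J[OF that(1)] phi(2) that unfolding M0_def by blast
    consider "e \<in> M0" "e' \<in> M0" | b where "e \<in> M0" "b \<in> B" "e' = {b, \<phi> b}"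
      | b where "e' \<in> M0" "b \<in> B" "e = {b, \<phi> b}"
      | b b' where "b \<in> B" "b' \<in> B" "e = {b, \<phi> b}" "e' = {b', \<phi> b'}"
      using e(1,2) unfolding W_def by blast
    then show ?thesis
    proof cases
      case 1
      then show ?thesis using m e(3) unfolding matching_def M0_def by blast
    next
      case 2
      then show ?thesis using star by blast
    next
      case 3
      then show ?thesis using star by blast
    next
      case 4
      then have "b \<noteq> b'" using e(3) by blast
      then have "\<phi> b \<noteq> \<phi> b'" using phi(1) 4 unfolding inj_on_def by blast
      moreover have "\<phi> b \<noteq> b'" "\<phi> b' \<noteq> b" using phi(2) BJ 4 by blast+
      ultimately show ?thesis using \<open>b \<noteq> b'\<close> 4 by auto
    qed
  qed
  ultimately have mW: "matching G W" unfolding matching_def by blast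
  have "M0 \<inter> (\<lambda>b. {b, \<phi> b}) ` B = {}" unfolding M0_def by auto
  then have cW: "card W = card M0 + card B"
    unfolding W_def using Mfin finB card_image[OF inj] by (simp add: card_Un_disjoint M0_def)
  \<comment> \<open>Each discarded edge is charged to one of its ends in \<open>B\<close>. Edges of
    a matching are disjoint, so at most \<open>card (B \<inter> \<Union>M)\<close> edges are lost
    while \<open>card B\<close> are gained.\<close>
  define g where "g e = (SOME b. b \<in> e \<inter> B)" for e
  have g: "g e \<in> e \<inter> B" if "e \<in> M - M0" for e
    using that some_in_eq[of "e \<inter> B"] unfolding g_def M0_def by simp
  have "inj_on g (M - M0)"
  proof (rule inj_onI)
    fix e e' assume "e \<in> M - M0" "e' \<in> M - M0" "g e = g e'"
    then show "e = e'" using g[of e] g[of e'] matching_eqI[OF m, of e e' "g e"] by auto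
  qed
  moreover have "g ` (M - M0) \<subseteq> B \<inter> \<Union>M" using g by blast
  ultimately have "card (M - M0) \<le> card (B \<inter> \<Union>M)"
    using finB by (metis card_inj_on_le finite_Int)
  moreover have "card M = card M0 + card (M - M0)"
    using Mfin by (metis (no_types, lifting) M0_def card_Diff_subset card_mono finite_subset
        le_add_diff_inverse mem_Collect_eq subsetI)
  ultimately have le: "card M \<le> card M0 + card (B \<inter> \<Union>M)" by simp
  have "card W \<le> card M" using mW M unfolding maximum_matching_def by blast
  then have "card B \<le> card (B \<inter> \<Union>M)" using le cW by simp
  then show "B \<subseteq> \<Union>M"
    using finB by (metis Int_lower1 Int_lower2 card_seteq)
  have "card M \<le> card W" using le cW card_mono[OF finB, of "B \<inter> \<Union>M"] by auto
  then show "maximum_matching G ({e \<in> M. e \<inter> B = {}} \<union> (\<lambda>b. {b, \<phi> b}) ` B)"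
    using maximum_matchingI[OF M mW] unfolding W_def M0_def by simp
qed

text \<open>The exchange works for every maximum matching, so none of them misses a vertex of
  \<open>B\<close>. After the exchange the only edges at \<open>J\<close> are the
  \<open>{b, \<phi> b}\<close>, so a vertex of \<open>J\<close> outside the image of
  \<open>\<phi>\<close> is missed.\<close>

lemma barrier_GE_D:
  assumes G: "simple_graph G" and J: "\<forall>u w. u \<in> J \<longrightarrow> {u, w} \<in> edges G \<longrightarrow> w \<in> B"
    and JV: "J \<subseteq> verts G"
    and BJ: "B \<inter> J = {}" and phi: "inj_on \<phi> B" "\<forall>b\<in>B. \<phi> b \<in> J \<and> {b, \<phi> b} \<in> edges G"
    and M: "maximum_matching G M"
  shows "B \<inter> GE_D G = {}" and "J - \<phi> ` B \<subseteq> GE_D G"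
proof -
  show "B \<inter> GE_D G = {}"
  proof (rule ccontr)
    assume "B \<inter> GE_D G \<noteq> {}"
    then obtain b N where b: "b \<in> B" "b \<notin> \<Union>N" and N: "maximum_matching G N"
      unfolding GE_D_def by blast
    then show False using barrier(1)[OF G J BJ phi(1,2) N] by blast
  qed
  define W where "W = {e \<in> M. e \<inter> B = {}} \<union> (\<lambda>b. {b, \<phi> b}) ` B"
  have W: "maximum_matching G W" using barrier(2)[OF G J BJ phi(1,2) M] unfolding W_def by blast
  show "J - \<phi> ` B \<subseteq> GE_D G"
  proof
    fix j assume j: "j \<in> J - \<phi> ` B"
    have "j \<notin> e" if "e \<in> M" "e \<inter> B = {}" for e
    proof
      assume "j \<in> e"
      have "e \<in> edges G" using that maximum_matchingD[OF M] unfolding matching_def by blast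
      then obtain w where "e = {j, w}" using edgeE[OF G _ \<open>j \<in> e\<close>] by blast
      then show False using J j \<open>e \<in> edges G\<close> that by blast
    qed
    then have "j \<notin> \<Union>W" using j BJ unfolding W_def by blast
    then show "j \<in> GE_D G" using W j JV unfolding GE_D_def by blast
  qed
qed

text \<open>For a minimal violator \<open>X\<close>, each \<open>X - {i}\<close> is matched onto the
  neighbours of \<open>X\<close> in \<open>Z\<close>. Together with the edges of \<open>M\<close> at
  \<open>A\<close> this forms a barrier, which puts \<open>X\<close> into \<open>GE_D G\<close> and
  all its neighbours outside. So \<open>X\<close> consists of isolated vertices of
  \<open>G[D]\<close> outside \<open>R\<close>, hence outside \<open>D_minus G M\<close>;
  \<open>M\<close> covers them all and injects \<open>X\<close> into a smaller set.\<close>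

lemma hall_condition_rest:
  assumes G: "simple_graph G" and M: "maximum_matching G M"
    and R: "D_minus G M \<subseteq> R" "R \<subseteq> isolated (induced G (GE_D G))"
    and closed: "\<forall>d a. d \<in> R \<longrightarrow> {d, a} \<in> edges G \<longrightarrow> (\<exists>x\<in>R. {a, x} \<in> M)"
  defines "Z \<equiv> verts G - R - nbhd_set G R"
  assumes "Y \<subseteq> Z"
  shows "card Y \<le> card (\<Union>x\<in>Y. nbhd G x \<inter> Z)"
proof (rule ccontr)
  assume "\<not> ?thesis"
  define NZ where "NZ X = (\<Union>x\<in>X. nbhd G x \<inter> Z)" for X
  define A where "A = nbhd_set G R"
  note m = maximum_matchingD[OF M]
  have finV: "finite (verts G)" using G unfolding simple_graph_def by blast
  have finZ: "finite Z" using finV unfolding Z_def by simp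
  have RD: "R \<subseteq> GE_D G" and indep: "\<And>d a. d \<in> R \<Longrightarrow> {d, a} \<in> edges G \<Longrightarrow> a \<notin> GE_D G"
    using R(2) isolated_GE_D_iff[OF G] by blast+
  have A_iff: "a \<in> A \<longleftrightarrow> (\<exists>d\<in>R. {d, a} \<in> edges G)" for a
    unfolding A_def nbhd_set_def using mem_nbhd[OF G] by auto
  define Bad where "Bad = {X. X \<subseteq> Z \<and> card (NZ X) < card X}"
  have "finite Bad" by (rule finite_subset[of _ "Pow Z"]) (auto simp: Bad_def finZ)
  moreover have "Y \<in> Bad" using \<open>\<not> _\<close> \<open>Y \<subseteq> Z\<close> unfolding Bad_def NZ_def by simp
  ultimately obtain X where X: "X \<in> Bad" and minX: "\<And>X'. X' \<in> Bad \<Longrightarrow> X' \<subseteq> X \<Longrightarrow> X' = X"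
    using finite_has_minimal[of Bad] by (metis empty_iff)
  have XZ: "X \<subseteq> Z" and Xbad: "card (NZ X) < card X" using X unfolding Bad_def by auto
  have finX: "finite X" using XZ finZ finite_subset by blast
  have NZ_Z: "NZ X' \<subseteq> Z" for X' unfolding NZ_def by blast
  have finNZ: "finite (NZ X')" for X' using NZ_Z finZ finite_subset by blast
  \<comment> \<open>Removing the overlap with \<open>NZ X\<close> from \<open>X\<close> costs the
    neighbourhood at least the same set, so the smaller set still violates the condition and must
    equal \<open>X\<close>.\<close>
  have indepX: "X \<inter> NZ X = {}"
  proof -
    have "NZ (X - NZ X) \<subseteq> NZ X - X"
    proof
      fix w assume "w \<in> NZ (X - NZ X)"
      then obtain v where v: "v \<in> X" "v \<notin> NZ X" "{v, w} \<in> edges G" "w \<in> Z"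
        using mem_nbhd[OF G] unfolding NZ_def[of "X - NZ X"] by auto
      have "v \<in> NZ X" if "w \<in> X"
        using that v XZ mem_nbhd[OF G, of v w] unfolding NZ_def by (auto simp: insert_commute)
      then have "w \<notin> X" using v(2) by blast
      then show "w \<in> NZ X - X" using v mem_nbhd[OF G, of w v] unfolding NZ_def by blast
    qed
    then have "card (NZ (X - NZ X)) \<le> card (NZ X - X)" using finNZ by (intro card_mono) auto
    moreover have "card (NZ X - X) + card (X \<inter> NZ X) = card (NZ X)"
      using finNZ[of X] by (metis Int_commute card_Diff_subset_Int card_mono finite_Int
          Int_lower1 le_add_diff_inverse2)
    moreover have "card (X - NZ X) + card (X \<inter> NZ X) = card X"
      using finX by (metis card_Diff_subset_Int card_mono finite_Int
          Int_lower1 le_add_diff_inverse2)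
    ultimately have "X - NZ X \<in> Bad" using Xbad XZ unfolding Bad_def by auto
    then show ?thesis using minX[of "X - NZ X"] by blast
  qed
  define S where "S = NZ X"
  have nbX: "w \<in> S \<union> A" if "x \<in> X" "{x, w} \<in> edges G" for x w
  proof -
    have "w \<in> verts G" using edge_ends(2)[OF G that(2)] .
    moreover have "w \<notin> R" using that XZ A_iff[of x] unfolding Z_def A_def
      by (auto simp: insert_commute)
    ultimately show ?thesis using that mem_nbhd[OF G, of w x] unfolding S_def NZ_def Z_def A_def by auto
  qed
  have pA: "partner M a \<in> R \<and> {a, partner M a} \<in> M" if "a \<in> A" for a
    using that closed A_iff partner_eqI[OF m] by metis
  have key: "(A \<union> S) \<inter> GE_D G = {} \<and> i \<in> GE_D G" if i: "i \<in> X" for i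
  proof -
    have "\<exists>f. inj_on f (X - {i}) \<and> (\<forall>x\<in>X - {i}. f x \<in> nbhd G x \<inter> Z)"
    proof (rule hall_marriage)
      show "card Y' \<le> card (\<Union>x\<in>Y'. nbhd G x \<inter> Z)" if "Y' \<subseteq> X - {i}" for Y'
      proof (rule ccontr)
        assume "\<not> ?thesis"
        then have "Y' \<in> Bad" using that XZ unfolding Bad_def NZ_def by auto
        then show False using minX[of Y'] that i by blast
      qed
    qed (use finX finZ in auto)
    then obtain f where f: "inj_on f (X - {i})" "\<And>x. x \<in> X - {i} \<Longrightarrow> f x \<in> nbhd G x \<inter> Z" by blast
    have "f ` (X - {i}) \<subseteq> S" using f(2) unfolding S_def NZ_def by auto
    \<comment> \<open>Since \<open>card S < card X\<close>, the matching of \<open>X - {i}\<close>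
      into \<open>S\<close> has to use all of \<open>S\<close>, and so it can be inverted to send
      \<open>S\<close> back into \<open>X\<close>.\<close>
    moreover have "card S \<le> card (f ` (X - {i}))"
      using Xbad i finX card_image[OF f(1)] unfolding S_def by simp
    ultimately have fS: "f ` (X - {i}) = S" using finNZ unfolding S_def by (metis card_seteq)
    define g where "g = inv_into (X - {i}) f"
    have g: "g s \<in> X - {i}" "f (g s) = s" if "s \<in> S" for s
      using that fS inv_into_into[of s f "X - {i}"] f_inv_into_f[of s f "X - {i}"]
      unfolding g_def by simp_all
    define \<phi> where "\<phi> b = (if b \<in> A then partner M b else g b)" for b
    have AS: "A \<inter> S = {}" using NZ_Z unfolding S_def Z_def A_def by blast
    have JB: "\<forall>u w. u \<in> R \<union> X \<longrightarrow> {u, w} \<in> edges G \<longrightarrow> w \<in> A \<union> S"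
      using nbX A_iff by blast
    have disj: "(A \<union> S) \<inter> (R \<union> X) = {}"
    proof -
      have "A \<inter> R = {}" using A_iff indep RD by blast
      moreover have "A \<inter> X = {}" "S \<inter> R = {}" using XZ NZ_Z unfolding A_def S_def Z_def by blast+
      ultimately show ?thesis using indepX unfolding S_def by blast
    qed
    have phiJ: "\<phi> b \<in> R \<union> X \<and> {b, \<phi> b} \<in> edges G" if "b \<in> A \<union> S" for b
    proof (cases "b \<in> A")
      case True
      then show ?thesis using pA[OF True] m unfolding \<phi>_def matching_def by auto
    next
      case False
      then have "b \<in> S" using that by blast
      then show ?thesis using False g[of b] f(2)[of "g b"] mem_nbhd[OF G, of b "g b"]
        unfolding \<phi>_def by (auto simp: insert_commute)
    qed
    have inj: "inj_on \<phi> (A \<union> S)"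
    proof (rule inj_onI)
      fix b b' assume b: "b \<in> A \<union> S" "b' \<in> A \<union> S" "\<phi> b = \<phi> b'"
      have RX: "R \<inter> X = {}" using XZ unfolding Z_def by blast
      have cA: "\<phi> c \<in> R" if "c \<in> A" for c using pA[OF that] that unfolding \<phi>_def by simp
      have cS: "\<phi> c \<in> X" if "c \<in> S" for c using g[OF that] that AS unfolding \<phi>_def by auto
      consider "b \<in> A" "b' \<in> A" | "b \<in> S" "b' \<in> S" using b cA[of b] cA[of b'] cS[of b] cS[of b'] RX by auto
      then show "b = b'"
      proof cases
        case 1
        then have "{partner M b, b} \<in> M" "{partner M b, b'} \<in> M"
          using pA[of b] pA[of b'] b(3) unfolding \<phi>_def by (auto simp: insert_commute)
        then show ?thesis using matching_partner_unique[OF m] by blast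
      next
        case 2
        then have "b \<notin> A" "b' \<notin> A" using AS by blast+
        then have "g b = g b'" using b(3) unfolding \<phi>_def by simp
        then show ?thesis using g(2) 2 by metis
      qed
    qed
    have JV: "R \<union> X \<subseteq> verts G" using RD GE_D_subset[of G] XZ unfolding Z_def by blast
    have "i \<notin> \<phi> ` (A \<union> S)"
    proof
      assume "i \<in> \<phi> ` (A \<union> S)"
      then obtain b where "b \<in> A \<union> S" "i = \<phi> b" by blast
      then show False using g[of b] pA[of b] i XZ unfolding \<phi>_def Z_def by (auto split: if_splits)
    qed
    then show ?thesis
      using barrier_GE_D[OF G JB JV disj inj ballI[OF phiJ] M] i by blast
  qed
  have SX: "partner M x \<in> S \<and> {x, partner M x} \<in> M" if x: "x \<in> X" for x
  proof -
    have "x \<in> isolated (induced G (GE_D G))"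
      unfolding isolated_GE_D_iff[OF G] using key[OF x] nbX[OF x] by blast
    moreover have "x \<notin> R" using x XZ unfolding Z_def by blast
    ultimately have "x \<in> \<Union>M" using R(1) unfolding D_minus_def by blast
    then have xM: "{x, partner M x} \<in> M" using partner_edge[OF G m] by blast
    then have "partner M x \<in> S \<union> A" using nbX[OF x] m unfolding matching_def by blast
    \<comment> \<open>By closure the partners of vertices in \<open>A\<close> lie in
      \<open>R\<close>, and \<open>x\<close> does not.\<close>
    moreover have "partner M x \<notin> A"
    proof
      assume a: "partner M x \<in> A"
      have "{partner M x, x} \<in> M" using xM by (simp add: insert_commute)
      then have "x \<in> R" using pA[OF a] partner_eqI[OF m] by metis
      then show False using \<open>x \<notin> R\<close> by blast
    qed
    ultimately show ?thesis using xM by blast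
  qed
  have "inj_on (partner M) X"
  proof (rule inj_onI)
    fix x y assume "x \<in> X" "y \<in> X" "partner M x = partner M y"
    then have "{partner M x, x} \<in> M" "{partner M x, y} \<in> M"
      using SX[of x] SX[of y] by (auto simp: insert_commute)
    then show "x = y" using matching_partner_unique[OF m] by blast
  qed
  moreover have "partner M ` X \<subseteq> S" using SX by blast
  ultimately have "card X \<le> card S" using finNZ card_inj_on_le unfolding S_def by blast
  then show False using Xbad unfolding S_def by simp
qed

text \<open>Neighbourhoods were restricted to \<open>Z\<close> so that the representatives map the
  finite set \<open>Z\<close> injectively into itself. The permutation has no fixed point in
  \<open>Z\<close>, as \<open>{z, \<pi> z}\<close> is an edge.\<close>

lemma rest_permutation:
  assumes G: "simple_graph G" and M: "maximum_matching G M"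
    and R: "D_minus G M \<subseteq> R" "R \<subseteq> isolated (induced G (GE_D G))"
    and closed: "\<forall>d a. d \<in> R \<longrightarrow> {d, a} \<in> edges G \<longrightarrow> (\<exists>x\<in>R. {a, x} \<in> M)"
  defines "Z \<equiv> verts G - R - nbhd_set G R"
  obtains \<pi> where "\<pi> permutes Z" "\<forall>z\<in>Z. {z, \<pi> z} \<in> edges G"
proof -
  have finZ: "finite Z" using G unfolding simple_graph_def Z_def by simp
  have "\<exists>f. inj_on f Z \<and> (\<forall>x\<in>Z. f x \<in> nbhd G x \<inter> Z)"
  proof (rule hall_marriage[OF finZ])
    show "card Y \<le> card (\<Union>x\<in>Y. nbhd G x \<inter> Z)" if "Y \<subseteq> Z" for Y
      using hall_condition_rest[OF G M R closed] that unfolding Z_def by blast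
  qed (use finZ in auto)
  then obtain f where f: "inj_on f Z" "\<forall>x\<in>Z. f x \<in> nbhd G x \<inter> Z" by blast
  define \<pi> where "\<pi> z = (if z \<in> Z then f z else z)" for z
  have "f ` Z = Z" using f finZ endo_inj_surj[of Z f] by auto
  then have "bij_betw \<pi> Z Z" using f(1) unfolding bij_betw_def \<pi>_def by (auto simp: inj_on_def)
  then have "\<pi> permutes Z" by (rule bij_imp_permutes) (simp add: \<pi>_def)
  moreover have "\<forall>z\<in>Z. {z, \<pi> z} \<in> edges G" using f(2) mem_nbhd[OF G] unfolding \<pi>_def by auto
  ultimately show thesis using that by blast
qed

section \<open>Fractional matchings and isolated vertices\<close>

lemma isolated_delete_iff:
  assumes "simple_graph G"
  shows "v \<in> isolated (delete_verts G S) \<longleftrightarrow> v \<in> verts G \<and> v \<notin> S \<and> nbhd G v \<subseteq> S"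
  unfolding isolated_def delete_verts_def induced_def nbhd_def by auto

lemma sum_incident:
  fixes f :: "'a set \<Rightarrow> real"
  assumes G: "simple_graph G" and "finite X"
  shows "(\<Sum>v\<in>X. \<Sum>e\<in>{e \<in> edges G. v \<in> e}. f e) = (\<Sum>e\<in>edges G. real (card (e \<inter> X)) * f e)"
proof -
  have "(\<Sum>v\<in>X. \<Sum>e\<in>{e \<in> edges G. v \<in> e}. f e) = (\<Sum>v\<in>X. \<Sum>e\<in>edges G. if v \<in> e then f e else 0)"
    using finite_edges[OF G] by (simp add: sum.inter_filter)
  also have "\<dots> = (\<Sum>e\<in>edges G. \<Sum>v\<in>X. if v \<in> e then f e else 0)" by (rule sum.swap)
  also have "\<dots> = (\<Sum>e\<in>edges G. real (card (e \<inter> X)) * f e)"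
  proof (rule sum.cong)
    fix e
    have "{v \<in> X. v \<in> e} = e \<inter> X" by blast
    then show "(\<Sum>v\<in>X. if v \<in> e then f e else 0) = real (card (e \<inter> X)) * f e"
      using \<open>finite X\<close> by (simp add: sum.inter_filter[symmetric])
  qed simp
  finally show ?thesis .
qed

text \<open>Weak duality for the fractional vertex cover with weight 1 on \<open>S\<close>, 0 on the
  isolated vertices of \<open>G - S\<close> and 1/2 elsewhere. It is a cover because every edge at
  an isolated vertex has its other end in \<open>S\<close>.\<close>

lemma fractional_matching_upper:
  assumes G: "simple_graph G" and S: "S \<subseteq> verts G" and f: "fractional_matching G f"
  shows "2 * (\<Sum>e\<in>edges G. f e) \<le>
    real (card (verts G)) - real (iso_num (delete_verts G S)) + real (card S)"
proof -
  define I where "I = isolated (delete_verts G S)"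
  define T where "T = verts G - I - S"
  define F where "F v = (\<Sum>e\<in>{e \<in> edges G. v \<in> e}. f e)" for v
  have finV: "finite (verts G)" using G unfolding simple_graph_def by blast
  have I_iff: "v \<in> I \<longleftrightarrow> v \<in> verts G \<and> v \<notin> S \<and> nbhd G v \<subseteq> S" for v
    unfolding I_def by (rule isolated_delete_iff[OF G])
  have IV: "I \<subseteq> verts G" and IS: "I \<inter> S = {}" using I_iff by auto
  have fin: "finite I" "finite S" "finite T"
    using finV IV S finite_subset unfolding T_def by blast+
  have F1: "F v \<le> 1" if "v \<in> verts G" for v
    using f that unfolding fractional_matching_def F_def by blast
  have f0: "0 \<le> f e" if "e \<in> edges G" for e
    using f that unfolding fractional_matching_def by blast
  have V: "verts G = I \<union> S \<union> T" using S IV unfolding T_def by blast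
  have sumV: "sum h (verts G) = sum h I + sum h S + sum h T" for h :: "'a \<Rightarrow> real"
    unfolding V using fin IS by (subst sum.union_disjoint, auto simp: T_def sum.union_disjoint)
  have "(\<Sum>v\<in>I. F v) \<le> (\<Sum>v\<in>S. F v)"
    unfolding F_def sum_incident[OF G fin(1)] sum_incident[OF G fin(2)]
  proof (intro sum_mono mult_right_mono f0)
    fix e assume e: "e \<in> edges G"
    have "card (e \<inter> I) \<le> card (e \<inter> S)"
    proof (cases "e \<inter> I = {}")
      case False
      then obtain v where v: "v \<in> e" "v \<in> I" by blast
      then obtain w where w: "e = {v, w}" using edgeE[OF G e] by blast
      then have "w \<in> S" using v e I_iff mem_nbhd[OF G, of w v] by blast
      then have "e \<inter> I = {v}" "e \<inter> S = {w}" using v w IS by auto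
      then show ?thesis by simp
    qed simp
    then show "real (card (e \<inter> I)) \<le> real (card (e \<inter> S))" by simp
  qed
  moreover have "(\<Sum>v\<in>S. F v) \<le> real (card S)"
    using sum_mono[of S F "\<lambda>_. 1"] F1 S by auto
  moreover have "(\<Sum>v\<in>T. F v) \<le> real (card T)"
    using sum_mono[of T F "\<lambda>_. 1"] F1 unfolding T_def by auto
  moreover have "real (card (verts G)) = real (card I) + real (card S) + real (card T)"
    using sumV[of "\<lambda>_. 1"] by simp
  moreover have "(\<Sum>v\<in>verts G. F v) = (\<Sum>e\<in>edges G. 2 * f e)"
    unfolding F_def sum_incident[OF G finV]
  proof (rule sum.cong)
    fix e assume "e \<in> edges G"
    then have "e \<inter> verts G = e" "card e = 2" using G unfolding simple_graph_def by auto
    then show "real (card (e \<inter> verts G)) * f e = 2 * f e" by simp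
  qed simp
  ultimately show ?thesis
    unfolding iso_num_def I_def[symmetric] using sumV[of F] by (simp add: sum_distrib_left[symmetric])
qed

text \<open>The real \<open>Sup\<close> is informative only for a non-empty bounded set; the crude
  bound is the case \<open>S = {}\<close> of the preceding estimate.\<close>

lemma fractional_matching_values:
  assumes G: "simple_graph G"
  shows "{\<Sum>e\<in>edges G. f e | f. fractional_matching G f} \<noteq> {}"
    and "bdd_above {\<Sum>e\<in>edges G. f e | f. fractional_matching G f}"
proof -
  have "fractional_matching G (\<lambda>_. 0)" unfolding fractional_matching_def by simp
  then show "{\<Sum>e\<in>edges G. f e | f. fractional_matching G f} \<noteq> {}" by blast
  show "bdd_above {\<Sum>e\<in>edges G. f e | f. fractional_matching G f}"
  proof (rule bdd_aboveI[of _ "real (card (verts G))"])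
    fix x assume "x \<in> {\<Sum>e\<in>edges G. f e | f. fractional_matching G f}"
    then obtain f where "fractional_matching G f" "x = (\<Sum>e\<in>edges G. f e)" by blast
    then show "x \<le> real (card (verts G))"
      using fractional_matching_upper[OF G, of "{}" f] by simp
  qed
qed

lemma fractional_matching_number_upper:
  assumes G: "simple_graph G" and S: "S \<subseteq> verts G"
  shows "2 * fractional_matching_number G \<le>
    real (card (verts G)) - real (iso_num (delete_verts G S)) + real (card S)"
proof -
  have "fractional_matching_number G \<le>
    (real (card (verts G)) - real (iso_num (delete_verts G S)) + real (card S)) / 2"
    unfolding fractional_matching_number_def
  proof (rule cSup_least[OF fractional_matching_values(1)[OF G]])
    fix x assume "x \<in> {\<Sum>e\<in>edges G. f e | f. fractional_matching G f}"
    then obtain f where "fractional_matching G f" "x = (\<Sum>e\<in>edges G. f e)" by blast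
    then show "x \<le> (real (card (verts G)) - real (iso_num (delete_verts G S)) + real (card S)) / 2"
      using fractional_matching_upper[OF G S] by fastforce
  qed
  then show ?thesis by simp
qed

lemma sum_card_fibres:
  assumes "finite Y" "finite T" "h ` Y \<subseteq> T"
  shows "(\<Sum>t\<in>T. card {y \<in> Y. h y = t}) = card Y"
  using sum.group[OF assms, of "\<lambda>_. 1 :: nat"] by simp

text \<open>Each \<open>v\<close> puts weight 1/2 on \<open>{v, \<sigma> v}\<close>, so an edge used
  in both directions gets weight 1. At a vertex \<open>u\<close> only \<open>u\<close> itself and
  its at most one preimage contribute.\<close>

lemma fractional_matching_number_lower:
  assumes G: "simple_graph G" and inj: "inj_on \<sigma> Y"
    and edge: "\<And>v. v \<in> Y \<Longrightarrow> {v, \<sigma> v} \<in> edges G"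
  shows "real (card Y) \<le> 2 * fractional_matching_number G"
proof -
  define f where "f e = real (card {v \<in> Y. {v, \<sigma> v} = e}) / 2" for e
  have YV: "Y \<subseteq> verts G" using edge edge_ends(1)[OF G] by blast
  then have finY: "finite Y" using G finite_subset unfolding simple_graph_def by blast
  note finE = finite_edges[OF G]
  have total: "(\<Sum>e\<in>E. f e) = real (card {v \<in> Y. {v, \<sigma> v} \<in> E}) / 2" if E: "E \<subseteq> edges G" for E
  proof -
    have "(\<Sum>e\<in>E. f e) = real (\<Sum>e\<in>E. card {v \<in> Y. {v, \<sigma> v} = e}) / 2"
      unfolding f_def by (simp add: sum_divide_distrib)
    also have "(\<Sum>e\<in>E. card {v \<in> Y. {v, \<sigma> v} = e}) =
        (\<Sum>e\<in>E. card {v \<in> {v \<in> Y. {v, \<sigma> v} \<in> E}. {v, \<sigma> v} = e})"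
      by (intro sum.cong refl arg_cong[where f = card]) auto
    also have "\<dots> = card {v \<in> Y. {v, \<sigma> v} \<in> E}"
      using finY finite_subset[OF E finE] by (intro sum_card_fibres) auto
    finally show ?thesis .
  qed
  have "fractional_matching G f"
    unfolding fractional_matching_def
  proof (intro conjI ballI)
    fix e assume e: "e \<in> edges G"
    show "0 \<le> f e" unfolding f_def by simp
    have "card e = 2" using G e unfolding simple_graph_def by blast
    moreover have "card {v \<in> Y. {v, \<sigma> v} = e} \<le> card e"
      using \<open>card e = 2\<close> by (intro card_mono) (auto intro: card_ge_0_finite)
    ultimately show "f e \<le> 1" unfolding f_def by simp
  next
    fix u
    have "{v \<in> Y. {v, \<sigma> v} \<in> {e \<in> edges G. u \<in> e}} \<subseteq> insert u {v \<in> Y. \<sigma> v = u}" by auto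
    then have "card {v \<in> Y. {v, \<sigma> v} \<in> {e \<in> edges G. u \<in> e}} \<le> card (insert u {v \<in> Y. \<sigma> v = u})"
      using finY by (intro card_mono) auto
    also have "\<dots> \<le> Suc (card {v \<in> Y. \<sigma> v = u})" using finY by (simp add: card_insert_if)
    also have "card {v \<in> Y. \<sigma> v = u} \<le> 1"
      using inj finY by (auto simp: card_le_Suc0_iff_eq inj_on_def)
    finally show "(\<Sum>e\<in>{e \<in> edges G. u \<in> e}. f e) \<le> 1" using total[of "{e \<in> edges G. u \<in> e}"] by auto
  qed
  then have "(\<Sum>e\<in>edges G. f e) \<le> fractional_matching_number G"
    unfolding fractional_matching_number_def
    using fractional_matching_values(2)[OF G] by (intro cSup_upper) auto
  moreover have "{v \<in> Y. {v, \<sigma> v} \<in> edges G} = Y" using edge by blast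
  ultimately show ?thesis using total[of "edges G"] by simp
qed

section \<open>Bounds on \<open>lam\<close>\<close>

lemma binding_number_ge_1:
  assumes G: "simple_graph G" and V: "verts G \<noteq> {}"
    and lam: "\<forall>S\<subseteq>verts G. int (iso_num (delete_verts G S)) \<le> lam * int (card S)"
  shows "1 \<le> lam"
proof -
  obtain v where v: "v \<in> verts G" using V by blast
  \<comment> \<open>Deleting every vertex but \<open>v\<close> leaves \<open>v\<close> isolated, so
    \<open>lam\<close> times a cardinality is positive; this also rules out a one-vertex
    graph.\<close>
  have "v \<in> isolated (delete_verts G (verts G - {v}))"
    unfolding isolated_delete_iff[OF G] using v mem_nbhd[OF G, of v v] edge_ends(3)[OF G, of v v]
    by (auto simp: nbhd_def)
  moreover have "finite (isolated (delete_verts G (verts G - {v})))"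
    using G unfolding isolated_def delete_verts_def induced_def simple_graph_def by auto
  ultimately have "iso_num (delete_verts G (verts G - {v})) > 0"
    unfolding iso_num_def using card_gt_0_iff by blast
  moreover have "int (iso_num (delete_verts G (verts G - {v}))) \<le> lam * int (card (verts G - {v}))"
    using lam by blast
  ultimately have "0 < lam * int (card (verts G - {v}))" by linarith
  then have "0 < lam"
    using mult_nonpos_nonneg[of lam "int (card (verts G - {v}))"] by linarith
  then show ?thesis by simp
qed

text \<open>If \<open>lam - 1\<close> fails at \<open>S\<close>, some vertex is isolated in
  \<open>G - S\<close>; its neighbourhood lies in \<open>S\<close>, so \<open>card S\<close> is at
  least the minimum degree. The bound \<open>n + card S\<close> on isolated vertices then makes
  \<open>lam - 2\<close> strictly smaller than the quotient, and rounding up leaves the summand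
  1.\<close>

lemma binding_number_le:
  assumes G: "simple_graph G" and V: "verts G \<noteq> {}"
    and lam: "\<forall>S\<subseteq>verts G. int (iso_num (delete_verts G S)) \<le> lam * int (card S)"
    and least: "\<forall>k::int. (\<forall>S\<subseteq>verts G. int (iso_num (delete_verts G S)) \<le> k * int (card S)) \<longrightarrow> lam \<le> k"
    and def: "\<And>S. S \<subseteq> verts G \<Longrightarrow> iso_num (delete_verts G S) \<le> n + card S"
  shows "lam \<le> \<lceil>real n / real (min_degree G)\<rceil> + 1"
proof (cases "lam \<le> 1")
  case True
  have "0 \<le> real n / real (min_degree G)" by simp
  then have "0 \<le> \<lceil>real n / real (min_degree G)\<rceil>" by linarith
  then show ?thesis using True by linarith
next
  case False
  have finV: "finite (verts G)" using G unfolding simple_graph_def by blast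
  \<comment> \<open>The case \<open>S = {}\<close> excludes isolated vertices of \<open>G\<close>.
    Positivity of the minimum degree is essential here, since division by 0 would yield 0.\<close>
  have deg: "degree G v > 0" if "v \<in> verts G" for v
  proof (rule ccontr)
    assume "\<not> ?thesis"
    moreover have "finite (nbhd G v)" using finV unfolding nbhd_def by simp
    ultimately have "v \<in> isolated (delete_verts G {})"
      using that unfolding isolated_delete_iff[OF G] degree_def by simp
    moreover have "finite (isolated (delete_verts G {}))"
      using finV unfolding isolated_def delete_verts_def induced_def by auto
    ultimately have "iso_num (delete_verts G {}) > 0"
      unfolding iso_num_def using card_gt_0_iff by blast
    then show False using lam[rule_format, of "{}"] by simp
  qed
  have delta: "min_degree G > 0"
    unfolding min_degree_def using finV V deg by (subst Min_gr_iff) auto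
  have "\<not> (\<forall>S\<subseteq>verts G. int (iso_num (delete_verts G S)) \<le> (lam - 1) * int (card S))"
  proof
    assume "\<forall>S\<subseteq>verts G. int (iso_num (delete_verts G S)) \<le> (lam - 1) * int (card S)"
    then have "lam \<le> lam - 1" using least by blast
    then show False by simp
  qed
  then obtain S where S: "S \<subseteq> verts G"
    and big: "(lam - 1) * int (card S) < int (iso_num (delete_verts G S))" by (meson not_le)
  have "0 \<le> (lam - 1) * int (card S)" using False by simp
  then have "isolated (delete_verts G S) \<noteq> {}" using big unfolding iso_num_def by auto
  then obtain v where v: "v \<in> verts G" "nbhd G v \<subseteq> S" using isolated_delete_iff[OF G] by blast
  have "min_degree G \<le> degree G v" unfolding min_degree_def using finV v(1) by simp
  also have "\<dots> \<le> card S"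
    unfolding degree_def using v(2) finite_subset[OF S finV] by (intro card_mono)
  finally have "(lam - 2) * int (min_degree G) \<le> (lam - 2) * int (card S)"
    using False by (intro mult_left_mono) auto
  also have "\<dots> < int n" using big def[OF S] by (simp add: algebra_simps)
  finally have "real_of_int ((lam - 2) * int (min_degree G)) < real_of_int (int n)"
    by (simp only: of_int_less_iff)
  then have "real_of_int (lam - 2) < real n / real (min_degree G)"
    using delta by (simp add: pos_less_divide_eq)
  then show ?thesis by linarith
qed

section \<open>Excess of star-cycle factors\<close>

text \<open>Starting from an assignment with fibres of size at most \<open>k\<close>, agreement with the reversed
  matching \<open>m\<close> can be increased as long as some fibre is empty.\<close>

lemma assignment_with_bounded_fibres:
  fixes N :: "'a \<Rightarrow> 'b set" and k :: nat
  assumes fin: "finite R" "finite A" and N: "\<And>r. r \<in> R \<Longrightarrow> N r \<subseteq> A" and k: "1 \<le> k"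
    and hall: "\<And>X. X \<subseteq> R \<Longrightarrow> card X \<le> k * card (\<Union>(N ` X))"
    and m: "inj_on m A" "\<And>a. a \<in> A \<Longrightarrow> m a \<in> R \<and> a \<in> N (m a)"
  obtains g where "\<And>r. r \<in> R \<Longrightarrow> g r \<in> N r"
    "\<And>a. a \<in> A \<Longrightarrow> \<exists>r\<in>R. g r = a" "\<And>a. a \<in> A \<Longrightarrow> card {r \<in> R. g r = a} \<le> k"
proof -
  define ok where "ok g \<longleftrightarrow> (\<forall>r\<in>R. g r \<in> N r) \<and> (\<forall>a\<in>A. card {r \<in> R. g r = a} \<le> k)" for g
  define agree where "agree g = {a \<in> A. g (m a) = a}" for g
  \<comment> \<open>Every element of \<open>A\<close> is offered in \<open>k\<close> copies; the
    second coordinate only separates members of the same fibre.\<close>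
  have "\<exists>f. inj_on f R \<and> (\<forall>r\<in>R. f r \<in> N r \<times> {..<k})"
  proof (rule hall_marriage[OF fin(1)])
    show "finite (N r \<times> {..<k})" if "r \<in> R" for r
      using N[OF that] fin(2) finite_subset by blast
    show "card X \<le> card (\<Union>r\<in>X. N r \<times> {..<k})" if "X \<subseteq> R" for X
    proof -
      have "(\<Union>r\<in>X. N r \<times> {..<k}) = \<Union>(N ` X) \<times> {..<k}" by blast
      then show ?thesis using hall[OF that] by (simp add: card_cartesian_product mult.commute)
    qed
  qed
  then obtain f where f: "inj_on f R" "\<And>r. r \<in> R \<Longrightarrow> f r \<in> N r \<times> {..<k}" by blast
  have "ok (\<lambda>r. fst (f r))"
    unfolding ok_def
  proof (intro conjI ballI)
    show "fst (f r) \<in> N r" if "r \<in> R" for r using f(2)[OF that] by auto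
    fix a
    have "inj_on (\<lambda>r. snd (f r)) {r \<in> R. fst (f r) = a}"
      using f(1) unfolding inj_on_def by (auto simp: prod_eq_iff)
    moreover have "(\<lambda>r. snd (f r)) ` {r \<in> R. fst (f r) = a} \<subseteq> {..<k}"
      using f(2) by fastforce
    ultimately show "card {r \<in> R. fst (f r) = a} \<le> k"
      using card_inj_on_le[of _ _ "{..<k}"] by fastforce
  qed
  moreover have "\<forall>g. ok g \<longrightarrow> card (agree g) < Suc (card A)"
    unfolding agree_def less_Suc_eq_le using fin(2) by (auto intro: card_mono)
  ultimately have "\<exists>g. ok g \<and> (\<forall>h. ok h \<longrightarrow> card (agree h) \<le> card (agree g))"
    by (rule ex_has_greatest_nat)
  then obtain g where g: "ok g" and max: "\<And>h. ok h \<Longrightarrow> card (agree h) \<le> card (agree g)" by blast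
  have "\<exists>r\<in>R. g r = a" if a: "a \<in> A" for a
  proof (rule ccontr)
    assume none: "\<not> ?thesis"
    \<comment> \<open>The fibre over \<open>a\<close> becomes a singleton and no other fibre grows.
      Another fibre may become empty, so the number of non-empty fibres is no measure of progress;
      agreement with \<open>m\<close> is, because injectivity of \<open>m\<close> preserves all
      earlier agreements.\<close>
    define h where "h = g(m a := a)"
    have fib_a: "{r \<in> R. h r = a} = {m a}" using none m(2)[OF a] unfolding h_def by auto
    have "{r \<in> R. h r = b} \<subseteq> {r \<in> R. g r = b}" if "b \<noteq> a" for b
      using that unfolding h_def by auto
    then have le: "card {r \<in> R. h r = b} \<le> card {r \<in> R. g r = b}" if "b \<noteq> a" for b
      using that fin(1) by (intro card_mono) auto
    have "card {r \<in> R. h r = b} \<le> k" if "b \<in> A" for b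
    proof (cases "b = a")
      case False
      then show ?thesis using le[OF False] g that unfolding ok_def by (meson order_trans)
    qed (use fib_a k in simp)
    moreover have "h r \<in> N r" if "r \<in> R" for r
      using g m(2)[OF a] that unfolding h_def ok_def by auto
    ultimately have "ok h" unfolding ok_def by blast
    have "h (m b) = b" if "b \<in> agree g" for b
      using that none m(2)[OF a] inj_onD[OF m(1), of b a] a unfolding h_def agree_def by auto
    then have "agree g \<subseteq> agree h" unfolding agree_def by auto
    moreover have "a \<in> agree h" "a \<notin> agree g"
      using a none m(2) unfolding agree_def h_def by auto
    ultimately have "card (agree g) < card (agree h)"
      using fin(2) unfolding agree_def by (intro psubset_card_mono) auto
    then show False using max[OF \<open>ok h\<close>] by simp
  qed
  then show thesis using that g unfolding ok_def by blast
qed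

section \<open>Excess of single components and of whole factors\<close>

lemma graph_iso_card: "graph_iso K H \<Longrightarrow> card (verts K) = card (verts H)"
  unfolding graph_iso_def using bij_betw_same_card by blast

lemma graph_iso_star_card: "graph_iso K (star i) \<Longrightarrow> card (verts K) = Suc i"
  using graph_iso_card[of K "star i"] by (simp add: star_def)

lemma graph_iso_star_center:
  assumes "graph_iso K (star i)" and K: "\<forall>e\<in>edges K. e \<subseteq> verts K"
  obtains c where "c \<in> verts K" "\<forall>e\<in>edges K. c \<in> e" "\<forall>w\<in>verts K - {c}. {c, w} \<in> edges K"
proof -
  obtain f where f: "bij_betw f (verts K) {0..i}"
    and E: "{{0, k} | k. 1 \<le> k \<and> k \<le> i} = (\<lambda>e. f ` e) ` edges K"
    using assms(1) unfolding graph_iso_def star_def by auto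
  have "0 \<in> f ` verts K" using f unfolding bij_betw_def by simp
  then obtain c where c: "c \<in> verts K" "f c = 0" by auto
  have inj: "inj_on f (verts K)" using f unfolding bij_betw_def by blast
  have "c \<in> e" if e: "e \<in> edges K" for e
  proof -
    have "f ` e \<in> {{0, k} | k. 1 \<le> k \<and> k \<le> i}" using e E by simp
    then have "f c \<in> f ` e" using c(2) by auto
    then show ?thesis using inj_on_image_mem_iff[OF inj c(1) K[rule_format, OF e]] by simp
  qed
  moreover have "{c, w} \<in> edges K" if w: "w \<in> verts K - {c}" for w
  proof -
    have "f w \<noteq> 0" using w c inj unfolding inj_on_def by (metis DiffE insertI1)
    moreover have "f w \<le> i" using w f unfolding bij_betw_def by auto
    ultimately have "{0, f w} \<in> {{0, k} | k. 1 \<le> k \<and> k \<le> i}" by auto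
    then have "f ` {c, w} \<in> (\<lambda>e. f ` e) ` edges K" unfolding E using c(2) by simp
    then obtain e where e: "e \<in> edges K" "f ` {c, w} = f ` e" by blast
    then have "e = {c, w}"
      using inj_on_image_eq_iff[OF inj _ K[rule_format, OF e(1)], of "{c, w}"] c w by simp
    then show ?thesis using e(1) by simp
  qed
  ultimately show thesis using that c(1) by blast
qed

text \<open>A center in \<open>R\<close> forces all \<open>i\<close> leaves into \<open>A\<close>.
  Otherwise a leaf in \<open>R\<close> forces the center into \<open>A\<close>, which offsets one of
  the at most \<open>i\<close> leaves in \<open>R\<close>.\<close>

lemma star_excess:
  assumes iso: "graph_iso K (star i)" "1 \<le> i" and K: "\<forall>e\<in>edges K. e \<subseteq> verts K"
    and RA: "R \<inter> A = {}" "\<forall>u w. u \<in> R \<longrightarrow> {u, w} \<in> edges K \<longrightarrow> w \<in> A"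
  shows "card (verts K \<inter> R) \<le> card (verts K \<inter> A) + (i - 1)"
proof -
  obtain c where c: "c \<in> verts K" "\<forall>w\<in>verts K - {c}. {c, w} \<in> edges K"
    using graph_iso_star_center[OF iso(1) K] by metis
  have card: "card (verts K) = Suc i" using graph_iso_star_card[OF iso(1)] .
  then have fin: "finite (verts K)" by (intro card_ge_0_finite) simp
  have leaves: "card (verts K - {c}) = i" using c(1) card fin by simp
  show ?thesis
  proof (cases "c \<in> R")
    case True
    then have "verts K - {c} \<subseteq> verts K \<inter> A" using c RA(2) by blast
    then have "verts K \<inter> R \<subseteq> {c}" "i \<le> card (verts K \<inter> A)"
      using RA(1) leaves fin card_mono[of "verts K \<inter> A" "verts K - {c}"] by auto
    moreover have "card (verts K \<inter> R) \<le> card {c}" using calculation(1) by (intro card_mono) auto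
    ultimately show ?thesis using iso(2) by simp
  next
    case False
    show ?thesis
    proof (cases "verts K \<inter> R = {}")
      case False
      then obtain w where w: "w \<in> verts K" "w \<in> R" by blast
      then have "{w, c} \<in> edges K" using c \<open>c \<notin> R\<close> by (auto simp: insert_commute)
      then have "c \<in> A" using RA(2) w by blast
      then have "card {c} \<le> card (verts K \<inter> A)" using c(1) fin by (intro card_mono) auto
      moreover have "card (verts K \<inter> R) \<le> i"
        using leaves fin \<open>c \<notin> R\<close> card_mono[of "verts K - {c}" "verts K \<inter> R"] by auto
      ultimately show ?thesis using iso(2) by simp
    qed simp
  qed
qed

text \<open>One step around the circuit is injective and takes vertices of \<open>R\<close> into
  \<open>A\<close>.\<close>

lemma circuit_excess:
  assumes iso: "graph_iso K (circuit m)" "3 \<le> m" and K: "\<forall>e\<in>edges K. e \<subseteq> verts K"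
    and RA: "\<forall>u w. u \<in> R \<longrightarrow> {u, w} \<in> edges K \<longrightarrow> w \<in> A"
  shows "card (verts K \<inter> R) \<le> card (verts K \<inter> A)"
proof -
  obtain f where f: "bij_betw f (verts K) {0..<m}"
    and E: "{{k, Suc k mod m} | k. k < m} = (\<lambda>e. f ` e) ` edges K"
    using iso(1) unfolding graph_iso_def circuit_def by auto
  have inj: "inj_on f (verts K)" and img: "f ` verts K = {0..<m}"
    using f unfolding bij_betw_def by auto
  define s where "s v = inv_into (verts K) f (Suc (f v) mod m)" for v
  have s: "s v \<in> verts K" "f (s v) = Suc (f v) mod m" if "v \<in> verts K" for v
  proof -
    have "Suc (f v) mod m \<in> f ` verts K" using img iso(2) by simp
    then show "s v \<in> verts K" "f (s v) = Suc (f v) mod m"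
      unfolding s_def by (simp_all add: inv_into_into f_inv_into_f)
  qed
  have "{v, s v} \<in> edges K" if v: "v \<in> verts K" for v
  proof -
    have "f v < m" using v img by auto
    then have "f ` {v, s v} \<in> {{k, Suc k mod m} | k. k < m}" using s(2)[OF v] by auto
    then obtain e where e: "e \<in> edges K" "f ` e = f ` {v, s v}" using E by auto
    then have "e = {v, s v}"
      using inj_on_image_eq_iff[OF inj K[rule_format, OF e(1)], of "{v, s v}"] v s(1)[OF v] by simp
    then show ?thesis using e(1) by simp
  qed
  then have "s ` (verts K \<inter> R) \<subseteq> verts K \<inter> A" using RA s(1) by blast
  moreover have "inj_on s (verts K \<inter> R)"
  proof (rule inj_onI)
    fix u v assume uv: "u \<in> verts K \<inter> R" "v \<in> verts K \<inter> R" "s u = s v"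
    then have "Suc (f u) mod m = Suc (f v) mod m" using s(2) by (metis IntD1)
    moreover have "f u < m" "f v < m" using uv img by auto
    ultimately have "f u = f v" by (auto simp: mod_Suc split: if_splits)
    then show "u = v" using inj uv unfolding inj_on_def by blast
  qed
  moreover have "finite (verts K)" using f bij_betw_finite by blast
  ultimately show ?thesis by (metis card_inj_on_le finite_Int)
qed

lemma suminf_star_count:
  assumes "\<And>i. T < i \<Longrightarrow> star_count F i = 0"
  shows "(\<Sum>i. i * star_count F (Suc i)) = (\<Sum>i=1..T. (i - 1) * star_count F i)"
proof -
  have "(\<Sum>i. i * star_count F (Suc i)) = (\<Sum>i<T. i * star_count F (Suc i))"
    using assms by (intro suminf_finite) auto
  also have "\<dots> = (\<Sum>i=1..T. (i - 1) * star_count F i)"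
    using sum.atLeast1_atMost_eq[of "\<lambda>i. (i - 1) * star_count F i" T] by simp
  finally show ?thesis .
qed

lemma star_count_eq_0:
  assumes V: "finite (verts F)" and i: "card (verts F) < i"
  shows "star_count F i = 0"
proof -
  have "\<not> graph_iso K (star i)" if K: "K \<in> components F" for K
  proof
    assume "graph_iso K (star i)"
    then have "card (verts K) = Suc i" by (rule graph_iso_star_card)
    moreover have "verts K \<subseteq> verts F" using componentsE(1)[OF K] by blast
    then have "card (verts K) \<le> card (verts F)" using V by (rule card_mono[rotated])
    ultimately show False using i by simp
  qed
  then have "star_components F i = {}" unfolding star_components_def by blast
  then show ?thesis unfolding star_count_def by simp
qed

text \<open>The lower bound for \<open>l_number\<close>: the components partition the vertices, and
  only stars can contain more of \<open>R\<close> than of \<open>A\<close>.\<close>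

lemma star_cycle_factor_excess:
  assumes G: "simple_graph G" and F: "star_cycle_factor G F"
    and RV: "R \<subseteq> verts G" and A: "A = nbhd_set G R" and RA: "R \<inter> A = {}"
  shows "card R \<le> card A + (\<Sum>i. i * star_count F (Suc i))"
proof -
  obtain t where F': "verts F = verts G" "edges F \<subseteq> edges G"
    "\<forall>K\<in>components F. \<exists>H\<in>stars_circuits t. graph_iso K H"
    using F unfolding star_cycle_factor_def is_factor_def by blast
  define T where "T = card (verts G)"
  define C where "C = components F"
  have finV: "finite (verts G)" using G unfolding simple_graph_def by blast
  have finC: "finite C" unfolding C_def using finite_components[of F] F'(1) finV by simp
  have sub: "verts K \<subseteq> verts G" if "K \<in> C" for K
    using componentsE(1) that F'(1) unfolding C_def by fastforce
  have comp: "K = induced F (verts K)" if K: "K \<in> C" for K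
    using componentsE(2,3) component_nonempty K unfolding C_def by metis
  \<comment> \<open>The type of a component is encoded as a sum over all \<open>i\<close>, so that
    exchanging the two sums below produces \<open>star_count\<close>. The cutoff \<open>T\<close> is
    safe because a star component has at most \<open>card (verts G)\<close> vertices.\<close>
  have per: "card (verts K \<inter> R) \<le>
      card (verts K \<inter> A) + (\<Sum>i=1..T. if graph_iso K (star i) then i - 1 else 0)" if K: "K \<in> C" for K
  proof -
    have KE: "e \<subseteq> verts K \<and> e \<in> edges G" if "e \<in> edges K" for e
    proof -
      have "e \<in> edges (induced F (verts K))" using that comp[OF K] by simp
      then show ?thesis unfolding induced_def using F'(2) by auto
    qed
    then have KE1: "\<forall>e\<in>edges K. e \<subseteq> verts K" by blast
    have RAK: "\<forall>u w. u \<in> R \<longrightarrow> {u, w} \<in> edges K \<longrightarrow> w \<in> A"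
      using KE mem_nbhd[OF G] unfolding A nbhd_set_def by blast
    obtain H where H: "H \<in> stars_circuits t" "graph_iso K H" using F'(3) K unfolding C_def by blast
    then consider i where "1 \<le> i" "graph_iso K (star i)" | m where "3 \<le> m" "graph_iso K (circuit m)"
      unfolding stars_circuits_def by auto
    then show ?thesis
    proof cases
      case (1 i)
      have "Suc i \<le> T" using graph_iso_star_card[OF 1(2)] card_mono[OF finV sub[OF K]] unfolding T_def by simp
      then have "(if graph_iso K (star i) then i - 1 else 0) \<le>
          (\<Sum>i=1..T. if graph_iso K (star i) then i - 1 else 0)"
        using 1(1) by (intro member_le_sum) auto
      then show ?thesis using star_excess[OF 1(2,1) KE1 RA RAK] 1(2) by simp
    next
      case (2 m)
      then show ?thesis using circuit_excess[OF 2(2,1) KE1 RAK] by fastforce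
    qed
  qed
  have "R \<subseteq> (\<Union>K\<in>C. verts K \<inter> R)"
  proof
    fix r assume r: "r \<in> R"
    then have "r \<in> verts F" using RV F'(1) by blast
    then show "r \<in> (\<Union>K\<in>C. verts K \<inter> R)"
      using component_of[of r F] verts_induced_class[of F r] r unfolding C_def by blast
  qed
  then have "card R \<le> card (\<Union>K\<in>C. verts K \<inter> R)"
    using finC finite_subset[OF sub finV] by (intro card_mono) auto
  also have "\<dots> \<le> (\<Sum>K\<in>C. card (verts K \<inter> R))" by (rule card_UN_le[OF finC])
  also have "\<dots> \<le> (\<Sum>K\<in>C. card (verts K \<inter> A) + (\<Sum>i=1..T. if graph_iso K (star i) then i - 1 else 0))"
    by (rule sum_mono[OF per])
  also have "\<dots> = (\<Sum>K\<in>C. card (verts K \<inter> A)) +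
      (\<Sum>K\<in>C. \<Sum>i=1..T. if graph_iso K (star i) then i - 1 else 0)" by (rule sum.distrib)
  also have "(\<Sum>K\<in>C. card (verts K \<inter> A)) = card (\<Union>K\<in>C. verts K \<inter> A)"
  proof (rule card_UN_disjoint[symmetric, OF finC])
    show "\<forall>K\<in>C. finite (verts K \<inter> A)" using finite_subset[OF sub finV] by blast
    show "\<forall>K\<in>C. \<forall>L\<in>C. K \<noteq> L \<longrightarrow> verts K \<inter> A \<inter> (verts L \<inter> A) = {}"
    proof (intro ballI impI, rule ccontr)
      fix K L assume KL: "K \<in> C" "L \<in> C" "K \<noteq> L" "verts K \<inter> A \<inter> (verts L \<inter> A) \<noteq> {}"
      then obtain v where "v \<in> verts K" "v \<in> verts L" by blast
      then show False
        using componentsE(2)[of K F v] componentsE(2)[of L F v] KL(1-3) unfolding C_def by simp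
    qed
  qed
  also have "\<dots> \<le> card A"
  proof (rule card_mono)
    show "finite A" unfolding A nbhd_set_def nbhd_def using finV finite_subset[OF RV] by auto
  qed blast
  also have "(\<Sum>K\<in>C. \<Sum>i=1..T. if graph_iso K (star i) then i - 1 else 0) =
      (\<Sum>i=1..T. \<Sum>K\<in>C. if graph_iso K (star i) then i - 1 else 0)" by (rule sum.swap)
  also have "\<dots> = (\<Sum>i=1..T. (i - 1) * star_count F i)"
    using finC unfolding star_count_def star_components_def C_def
    by (intro sum.cong refl) (simp add: sum.inter_filter[symmetric] mult.commute)
  also have "\<dots> = (\<Sum>i. i * star_count F (Suc i))"
    using star_count_eq_0[of F] finV unfolding F'(1) T_def by (intro suminf_star_count[symmetric]) simp
  finally show ?thesis by simp
qed

section \<open>Factors from an assignment and a permutation\<close>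

text \<open>Components are parametrised by the model graph, while \<open>graph_iso K H\<close> asks
  for a map out of the component.\<close>

lemma graph_iso_sym:
  assumes h: "bij_betw h (verts H) (verts K)" and E: "edges K = (\<lambda>e. h ` e) ` edges H"
    and H: "\<forall>e\<in>edges H. e \<subseteq> verts H"
  shows "graph_iso K H"
proof -
  define f where "f = inv_into (verts H) h"
  have "bij_betw f (verts K) (verts H)" unfolding f_def using h by (rule bij_betw_inv_into)
  moreover have "f ` h ` e = e" if "e \<in> edges H" for e
    using H that h unfolding f_def bij_betw_def by (metis inv_into_image_cancel)
  then have "edges H = (\<lambda>e. f ` e) ` edges K" unfolding E by (force simp: image_iff)
  ultimately show ?thesis unfolding graph_iso_def by blast
qed

lemma induced_star_iso:
  assumes "finite L" "c \<notin> L" "verts K = insert c L" "edges K = (\<lambda>r. {c, r}) ` L"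
  shows "graph_iso K (star (card L))"
proof -
  obtain e where e: "bij_betw e {1..card L} L"
    using ex_bij_betw_nat_finite_1[OF assms(1)] by blast
  define h where "h k = (if k = 0 then c else e k)" for k
  have verts: "verts (star (card L)) = insert 0 {1..card L}" unfolding star_def by auto
  have img: "h ` {1..card L} = L" using e unfolding bij_betw_def h_def by auto
  have "inj_on h {1..card L} = inj_on e {1..card L}" by (rule inj_on_cong) (simp add: h_def)
  then have "inj_on h {1..card L}" using e unfolding bij_betw_def by blast
  moreover have "h 0 = c" unfolding h_def by simp
  ultimately have "bij_betw h (verts (star (card L))) (verts K)"
    unfolding verts assms(3) bij_betw_def inj_on_insert using img assms(2) by simp
  moreover have "edges K = (\<lambda>e. h ` e) ` edges (star (card L))"
  proof -
    have "edges (star (card L)) = (\<lambda>k. {0, k}) ` {1..card L}" unfolding star_def by auto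
    then have "(\<lambda>e. h ` e) ` edges (star (card L)) = (\<lambda>k. {c, h k}) ` {1..card L}"
      by (simp add: image_image h_def insert_commute)
    also have "\<dots> = (\<lambda>r. {c, r}) ` h ` {1..card L}" by (simp add: image_image)
    finally show ?thesis using img assms(4) by simp
  qed
  ultimately show ?thesis by (rule graph_iso_sym) (auto simp: star_def)
qed

text \<open>\<open>Z\<close> is covered by the cycles of the permutation \<open>\<pi>\<close>; the cycles of length two become copies
  of \<open>K\<^bsub>1,1\<^esub>\<close>.\<close>

locale star_orbit_graph =
  fixes G :: "'a sgraph" and R A Z :: "'a set" and g \<pi> :: "'a \<Rightarrow> 'a"
  assumes simple: "simple_graph G"
    and verts: "verts G = R \<union> A \<union> Z"
    and disj: "R \<inter> A = {}" "R \<inter> Z = {}" "A \<inter> Z = {}"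
    and g: "\<And>r. r \<in> R \<Longrightarrow> g r \<in> A \<and> {r, g r} \<in> edges G"
    and g_onto: "\<And>a. a \<in> A \<Longrightarrow> \<exists>r\<in>R. g r = a"
    and indep: "\<And>r r'. r \<in> R \<Longrightarrow> r' \<in> R \<Longrightarrow> {r, r'} \<notin> edges G"
    and perm: "\<pi> permutes Z"
    and perm_edge: "\<And>z. z \<in> Z \<Longrightarrow> {z, \<pi> z} \<in> edges G"
begin

definition F :: "'a sgraph" where
  "F = \<lparr>verts = verts G, edges = (\<lambda>r. {r, g r}) ` R \<union> (\<lambda>z. {z, \<pi> z}) ` Z\<rparr>"

definition leaves :: "'a \<Rightarrow> 'a set" where
  "leaves a = {r \<in> R. g r = a}"

lemma F_simps: "verts F = verts G" "edges F = (\<lambda>r. {r, g r}) ` R \<union> (\<lambda>z. {z, \<pi> z}) ` Z"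
  unfolding F_def by simp_all

lemma edges_F_subset: "edges F \<subseteq> edges G"
  using g perm_edge unfolding F_simps by auto

lemma fin: "finite R" "finite A" "finite Z"
  using simple unfolding simple_graph_def verts by auto

lemma perm_Z: "z \<in> Z \<Longrightarrow> \<pi> z \<in> Z"
  using perm permutes_in_image by metis

lemma permutation: "permutation \<pi>"
  using perm fin(3) permutation_permutes by blast

lemma orbit_sub: "z \<in> Z \<Longrightarrow> orbit \<pi> z \<subseteq> Z"
  using permutes_orbit_subset[OF perm] .

lemma self_orbit: "z \<in> orbit \<pi> z"
  using permutation_self_in_orbit[OF permutation] .

lemma orbit_eq: "w \<in> orbit \<pi> z \<Longrightarrow> orbit \<pi> w = orbit \<pi> z"
  using orbit_cyclic_eq3[OF cyclic_on_orbit'[OF permutation]] .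

lemma perm_neq: "z \<in> Z \<Longrightarrow> \<pi> z \<noteq> z"
  using edge_ends(3)[OF simple perm_edge] by fastforce

text \<open>The predicted component of \<open>F\<close> at \<open>v\<close>. It is constant along
  edges of \<open>F\<close>, so nothing outside it can be reached.\<close>

definition piece :: "'a \<Rightarrow> 'a set" where
  "piece v = (if v \<in> R then insert (g v) (leaves (g v)) else if v \<in> A then insert v (leaves v)
    else orbit \<pi> v)"

lemma piece_R: "r \<in> R \<Longrightarrow> piece r = insert (g r) (leaves (g r))"
  and piece_A: "a \<in> A \<Longrightarrow> piece a = insert a (leaves a)"
  and piece_Z: "z \<in> Z \<Longrightarrow> piece z = orbit \<pi> z"
  using disj unfolding piece_def by auto

lemma piece_edge: "{u, w} \<in> edges F \<Longrightarrow> piece u = piece w"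
proof -
  assume "{u, w} \<in> edges F"
  then consider r where "r \<in> R" "{u, w} = {r, g r}" | z where "z \<in> Z" "{u, w} = {z, \<pi> z}"
    unfolding F_simps by auto
  then show ?thesis
  proof cases
    case (1 r)
    then have "piece r = piece (g r)" using piece_R piece_A g by simp
    then show ?thesis using 1(2) by (auto simp: doubleton_eq_iff)
  next
    case (2 z)
    then have "piece z = piece (\<pi> z)"
      using piece_Z perm_Z orbit_eq[OF orbit.base] by metis
    then show ?thesis using 2(2) by (auto simp: doubleton_eq_iff)
  qed
qed

lemma piece_self: "v \<in> verts G \<Longrightarrow> v \<in> piece v"
  using self_orbit piece_R piece_A piece_Z unfolding verts leaves_def by auto

lemma reach_star: "a \<in> A \<Longrightarrow> r \<in> leaves a \<Longrightarrow> (a, r) \<in> reach F \<and> (r, a) \<in> reach F"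
  unfolding reach_def F_simps leaves_def verts by (auto simp: insert_commute)

lemma reach_orbit:
  assumes "z \<in> Z" "w \<in> orbit \<pi> z"
  shows "(z, w) \<in> reach F"
proof -
  have "(z, w) \<in> {(x, y). {x, y} \<in> edges F}\<^sup>* \<and> w \<in> Z"
    using assms(2)
  proof induction
    case base
    then show ?case using assms(1) perm_Z unfolding F_simps by auto
  next
    case (step y)
    then have "{y, \<pi> y} \<in> edges F" unfolding F_simps by auto
    then show ?case using step perm_Z by (auto intro: rtrancl_into_rtrancl)
  qed
  then show ?thesis using assms(1) unfolding reach_def F_simps verts by auto
qed

lemma reach_class:
  assumes v: "v \<in> verts G"
  shows "reach F `` {v} = piece v"
proof
  show "reach F `` {v} \<subseteq> piece v"
  proof
    fix w assume "w \<in> reach F `` {v}"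
    then have w: "w \<in> verts G" "(v, w) \<in> {(x, y). {x, y} \<in> edges F}\<^sup>*"
      unfolding reach_def F_simps by auto
    from w(2) have "piece v = piece w"
      by induction (use piece_edge in auto)
    then show "w \<in> piece v" using piece_self[OF w(1)] by simp
  qed
  show "piece v \<subseteq> reach F `` {v}"
  proof
    fix w assume w: "w \<in> piece v"
    consider "v \<in> R" | "v \<in> A" | "v \<in> Z" using v verts by blast
    then show "w \<in> reach F `` {v}"
    proof cases
      case 1
      then have "v \<in> leaves (g v)" unfolding leaves_def by simp
      then have "(v, g v) \<in> reach F" using reach_star g 1 by blast
      moreover have "w = g v \<or> (g v, w) \<in> reach F" using w piece_R[OF 1] reach_star g 1 by blast
      ultimately show ?thesis
        using equiv_reach[of F] unfolding equiv_def trans_def by blast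
    next
      case 2
      have "(v, v) \<in> reach F" using v unfolding reach_def F_simps by simp
      then show ?thesis using w piece_A[OF 2] reach_star[OF 2] by auto
    next
      case 3
      then show ?thesis using w piece_Z[OF 3] reach_orbit by simp
    qed
  qed
qed

lemma component_cases:
  assumes "K \<in> components F"
  obtains (star) a where "a \<in> A" "K = induced F (insert a (leaves a))"
    | (orbit) z where "z \<in> Z" "K = induced F (orbit \<pi> z)"
proof -
  obtain v where v: "v \<in> verts G" "K = induced F (piece v)"
    using component_nonempty[OF assms] componentsE(1,2)[OF assms] reach_class F_simps(1) by metis
  consider "v \<in> R" | "v \<in> A" | "v \<in> Z" using v(1) verts by blast
  then show thesis
  proof cases
    case 1
    then show ?thesis using v(2) piece_R g star by metis
  next
    case 2
    then show ?thesis using v(2) piece_A star by metis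
  next
    case 3
    then show ?thesis using v(2) piece_Z orbit by metis
  qed
qed

lemma leaves_R: "leaves a \<subseteq> R"
  unfolding leaves_def by blast

text \<open>The leaves lie in the independent set \<open>R\<close>, so an edge of \<open>G\<close>
  inside the set passes through \<open>a\<close>, and \<open>F\<close> already contains every such
  edge.\<close>

lemma induced_star:
  assumes a: "a \<in> A"
  shows "verts (induced F (insert a (leaves a))) = insert a (leaves a)"
    and "edges (induced F (insert a (leaves a))) = (\<lambda>r. {a, r}) ` leaves a"
    and "induced F (insert a (leaves a)) = induced G (insert a (leaves a))"
proof -
  show V: "verts (induced F (insert a (leaves a))) = insert a (leaves a)"
    unfolding induced_def F_simps verts using a leaves_R by auto
  have G_sub: "e \<in> (\<lambda>r. {a, r}) ` leaves a" if e: "e \<in> edges G" "e \<subseteq> insert a (leaves a)" for e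
  proof -
    obtain u w where uw: "e = {u, w}" "u \<noteq> w"
      using simple e(1) unfolding simple_graph_def by (meson card_2_iff)
    then have "u = a \<or> w = a" using e indep leaves_R by blast
    then show ?thesis using uw e(2) by (auto simp: insert_commute)
  qed
  have F_sup: "(\<lambda>r. {a, r}) ` leaves a \<subseteq> edges F"
    unfolding F_simps leaves_def by (auto simp: insert_commute)
  show E: "edges (induced F (insert a (leaves a))) = (\<lambda>r. {a, r}) ` leaves a"
    using G_sub F_sup edges_F_subset unfolding induced_def by auto
  moreover have "edges (induced G (insert a (leaves a))) = (\<lambda>r. {a, r}) ` leaves a"
    using G_sub F_sup edges_F_subset unfolding induced_def by auto
  moreover have "verts (induced G (insert a (leaves a))) = insert a (leaves a)"
    using V unfolding induced_def F_simps by simp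
  ultimately show "induced F (insert a (leaves a)) = induced G (insert a (leaves a))"
    using V by (intro sgraph.equality) auto
qed

lemma star_iso:
  assumes a: "a \<in> A"
  shows "graph_iso (induced F (insert a (leaves a))) (star (card (leaves a)))" "1 \<le> card (leaves a)"
proof -
  have f: "finite (leaves a)" using fin(1) leaves_R finite_subset by blast
  then show "graph_iso (induced F (insert a (leaves a))) (star (card (leaves a)))"
    using induced_star_iso induced_star[OF a] leaves_R[of a] a disj(1) by (metis disjoint_iff subsetD)
  have "leaves a \<noteq> {}" using g_onto[OF a] unfolding leaves_def by blast
  then show "1 \<le> card (leaves a)" using f by (simp add: Suc_le_eq card_gt_0_iff)
qed

lemma induced_orbit:
  assumes z: "z \<in> Z"
  shows "verts (induced F (orbit \<pi> z)) = orbit \<pi> z"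
    and "edges (induced F (orbit \<pi> z)) = (\<lambda>w. {w, \<pi> w}) ` orbit \<pi> z"
proof -
  show "verts (induced F (orbit \<pi> z)) = orbit \<pi> z"
    unfolding induced_def F_simps verts using orbit_sub[OF z] by (simp add: Int_absorb1 le_supI2)
  have "r \<notin> orbit \<pi> z" if "r \<in> R" for r using that orbit_sub[OF z] disj(2) by auto
  then have "edges (induced F (orbit \<pi> z)) = {e \<in> (\<lambda>w. {w, \<pi> w}) ` Z. e \<subseteq> orbit \<pi> z}"
    unfolding induced_def F_simps by auto
  also have "\<dots> = (\<lambda>w. {w, \<pi> w}) ` orbit \<pi> z"
    using orbit_sub[OF z] by (auto intro: orbit.step)
  finally show "edges (induced F (orbit \<pi> z)) = (\<lambda>w. {w, \<pi> w}) ` orbit \<pi> z" .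
qed

text \<open>\<open>m\<close> is the first return time of \<open>z\<close> and \<open>h\<close> lists
  the iterates of \<open>\<pi>\<close>; the successor modulo \<open>m\<close> has the form used in
  \<open>circuit\<close>.\<close>

lemma orbit_enum:
  obtains m h where "0 < m" "m = card (orbit \<pi> z)" "bij_betw h {0..<m} (orbit \<pi> z)"
    "\<And>k. k < m \<Longrightarrow> h (Suc k mod m) = \<pi> (h k)"
proof
  define m where "m = funpow_dist1 \<pi> z z"
  define h where "h k = (\<pi> ^^ k) z" for k
  show "0 < m" unfolding m_def by simp
  show b: "bij_betw h {0..<m} (orbit \<pi> z)"
    unfolding bij_betw_def h_def m_def
    using inj_on_funpow_dist1[OF self_orbit] orbit_conv_funpow_dist1[OF self_orbit] by auto
  show "m = card (orbit \<pi> z)" using bij_betw_same_card[OF b] by simp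
  have "h m = z" unfolding h_def m_def by (rule funpow_dist1_prop[OF self_orbit])
  then show "h (Suc k mod m) = \<pi> (h k)" if "k < m" for k
    using that by (cases "Suc k = m") (auto simp: h_def)
qed

lemma orbit_iso:
  assumes z: "z \<in> Z"
  shows "graph_iso (induced F (orbit \<pi> z)) (star 1) \<or>
    (\<exists>m\<ge>3. graph_iso (induced F (orbit \<pi> z)) (circuit m))"
proof -
  obtain m h where m: "0 < m" "m = card (orbit \<pi> z)" and h: "bij_betw h {0..<m} (orbit \<pi> z)"
    and step: "\<And>k. k < m \<Longrightarrow> h (Suc k mod m) = \<pi> (h k)" using orbit_enum[of z] by metis
  have img: "h ` {0..<m} = orbit \<pi> z" using h unfolding bij_betw_def by blast
  have E: "edges (induced F (orbit \<pi> z)) = (\<lambda>k. {h k, h (Suc k mod m)}) ` {0..<m}"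
  proof -
    have "edges (induced F (orbit \<pi> z)) = (\<lambda>k. {h k, \<pi> (h k)}) ` {0..<m}"
      using induced_orbit(2)[OF z] unfolding img[symmetric] by (simp add: image_image)
    also have "\<dots> = (\<lambda>k. {h k, h (Suc k mod m)}) ` {0..<m}"
      using step by (intro image_cong) auto
    finally show ?thesis .
  qed
  have "finite (orbit \<pi> z)" using orbit_sub[OF z] fin(3) finite_subset by blast
  then have "card {z, \<pi> z} \<le> m" unfolding m(2) using self_orbit orbit.base by (intro card_mono) auto
  then have "2 \<le> m" using perm_neq[OF z] by (simp add: card_insert_if)
  then consider "m = 2" | "3 \<le> m" by linarith
  then show ?thesis
  proof cases
    case 1
    then have "{0..<m} = {0, 1}" by auto
    \<comment> \<open>For \<open>m = 2\<close> the steps from 0 and from 1 give the same undirected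
      edge.\<close>
    then have E2: "edges (induced F (orbit \<pi> z)) = {{h 0, h 1}}"
      unfolding E using 1 by (auto simp: insert_commute)
    have "edges (star 1) = {{0, 1}}" unfolding star_def by (auto simp: le_Suc_eq)
    moreover have "verts (star 1) = {0..<m}" unfolding star_def using 1 by auto
    ultimately have "graph_iso (induced F (orbit \<pi> z)) (star 1)"
      using E2 h induced_orbit(1)[OF z] 1 by (intro graph_iso_sym[of h]) auto
    then show ?thesis by blast
  next
    case 2
    have "edges (circuit m) = (\<lambda>k. {k, Suc k mod m}) ` {0..<m}" unfolding circuit_def by auto
    moreover have "verts (circuit m) = {0..<m}" unfolding circuit_def by simp
    ultimately have "graph_iso (induced F (orbit \<pi> z)) (circuit m)"
      using E h induced_orbit(1)[OF z] m(1)
      by (intro graph_iso_sym[of h]) (auto simp: image_image)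
    then show ?thesis using 2 by blast
  qed
qed

text \<open>A star has a vertex \<open>c\<close> on all its edges. The edge from
  \<open>\<pi> c\<close> to \<open>\<pi> (\<pi> c)\<close> must contain it, so the cycle has length
  two. Thus circuits never enter the star counts, and on two vertices a simple graph has no further
  edge.\<close>

lemma orbit_star:
  assumes z: "z \<in> Z" and iso: "graph_iso (induced F (orbit \<pi> z)) (star j)"
  shows "j = 1" and "induced F (orbit \<pi> z) = induced G (orbit \<pi> z)"
proof -
  define K where "K = induced F (orbit \<pi> z)"
  have "\<forall>e\<in>edges K. e \<subseteq> verts K"
    unfolding K_def induced_orbit[OF z] by (auto intro: orbit.step)
  then obtain c where c: "c \<in> verts K" "\<forall>e\<in>edges K. c \<in> e"
    using graph_iso_star_center[OF iso[folded K_def]] by metis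
  have cz: "c \<in> orbit \<pi> z" "c \<in> Z" using c(1) orbit_sub[OF z] unfolding K_def induced_orbit[OF z] by auto
  have "\<pi> c \<in> orbit \<pi> z" using cz(1) by (rule orbit.step)
  then have "{\<pi> c, \<pi> (\<pi> c)} \<in> edges K" unfolding K_def induced_orbit(2)[OF z] by blast
  then have "c \<in> {\<pi> c, \<pi> (\<pi> c)}" by (rule c(2)[THEN bspec])
  then have cc: "\<pi> (\<pi> c) = c" using perm_neq[OF cz(2)] by simp
  have "w = c \<or> w = \<pi> c" if "w \<in> orbit \<pi> c" for w
    using that by induction (use cc in auto)
  then have orb: "orbit \<pi> z = {c, \<pi> c}"
    using orbit_eq[OF cz(1)] self_orbit[of c] orbit.base[of \<pi> c] by auto
  then have "card (orbit \<pi> z) = 2" using perm_neq[OF cz(2)] by (simp add: card_insert_if)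
  then show "j = 1" using graph_iso_star_card[OF iso] induced_orbit(1)[OF z] by simp
  have "e = {c, \<pi> c}" if "e \<in> edges G" "e \<subseteq> {c, \<pi> c}" for e
  proof -
    have "card e = 2" using simple that(1) unfolding simple_graph_def by blast
    then show ?thesis using that(2) perm_neq[OF cz(2)] card_seteq[of "{c, \<pi> c}" e] by simp
  qed
  then have "edges (induced G (orbit \<pi> z)) = {{c, \<pi> c}}"
    using perm_edge[OF cz(2)] unfolding induced_def orb by auto
  moreover have "edges K = {{c, \<pi> c}}"
    unfolding K_def induced_orbit(2)[OF z] unfolding orb using cc by (auto simp: insert_commute)
  moreover have "verts (induced G (orbit \<pi> z)) = verts (induced F (orbit \<pi> z))"
    unfolding induced_def F_simps by simp
  ultimately show "induced F (orbit \<pi> z) = induced G (orbit \<pi> z)"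
    unfolding K_def by (intro sgraph.equality) auto
qed

lemma is_factor_F:
  assumes t: "1 \<le> t" and le: "\<And>a. a \<in> A \<Longrightarrow> int (card (leaves a)) \<le> t"
  shows "is_factor (stars_circuits t) G F"
  unfolding is_factor_def
proof (intro conjI ballI)
  fix K assume "K \<in> components F"
  then show "\<exists>H\<in>stars_circuits t. graph_iso K H"
  proof (cases rule: component_cases)
    case (star a)
    then have "star (card (leaves a)) \<in> stars_circuits t"
      using star_iso(2) le unfolding stars_circuits_def by blast
    then show ?thesis using star star_iso(1) by blast
  next
    case (orbit z)
    have "star 1 \<in> stars_circuits t" "m \<ge> 3 \<Longrightarrow> circuit m \<in> stars_circuits t" for m
      using t unfolding stars_circuits_def by force+
    then show ?thesis using orbit_iso[OF orbit(1)] orbit(2) by blast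
  qed
qed (use F_simps edges_F_subset in auto)

lemma star_componentE:
  assumes "K \<in> star_components F j"
  obtains a where "a \<in> A" "K = induced F (insert a (leaves a))" "j = card (leaves a)"
  | "j = 1"
proof -
  have K: "K \<in> components F" "graph_iso K (star j)" using assms unfolding star_components_def by auto
  from K(1) show thesis
  proof (cases rule: component_cases)
    case (star a)
    then have "Suc j = Suc (card (leaves a))"
      using graph_iso_star_card[OF K(2)] graph_iso_star_card[OF star_iso(1)[OF star(1)]] by simp
    then show ?thesis using that(1) star by simp
  next
    case (orbit z)
    then show ?thesis using that(2) orbit_star(1) K(2) by simp
  qed
qed

lemma star_component_induced:
  assumes "K \<in> star_components F j"
  shows "K = induced G (verts K)"
proof -
  have K: "K \<in> components F" "graph_iso K (star j)" using assms unfolding star_components_def by auto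
  from K(1) show ?thesis
  proof (cases rule: component_cases)
    case (star a)
    show ?thesis
      unfolding star(2) induced_star(1)[OF star(1)] by (rule induced_star(3)[OF star(1)])
  next
    case (orbit z)
    show ?thesis
      unfolding orbit(2) induced_orbit(1)[OF orbit(1)]
      by (rule orbit_star(2)[OF orbit(1) K(2)[unfolded orbit(2)]])
  qed
qed

text \<open>For \<open>2 \<le> j\<close> only the fibre stars remain, and in these every vertex
  other than \<open>a\<close> has degree at most one.\<close>

lemma star_component_center:
  assumes K: "K \<in> star_components F j" and j: "2 \<le> j" and c: "is_center K j c"
  shows "c \<in> A" "verts K - {c} \<subseteq> R"
proof -
  obtain a where a: "a \<in> A" "K = induced F (insert a (leaves a))" using K j by (cases rule: star_componentE) auto
  have V: "verts K = insert a (leaves a)" and E: "edges K = (\<lambda>r. {a, r}) ` leaves a"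
    unfolding a(2) using induced_star[OF a(1)] by auto
  have "c = a"
  proof (rule ccontr)
    assume "c \<noteq> a"
    then have "nbhd K c \<subseteq> {a}" unfolding nbhd_def E by (auto simp: doubleton_eq_iff)
    then have "degree K c \<le> card {a}" unfolding degree_def by (intro card_mono) auto
    then show False using c j unfolding is_center_def by simp
  qed
  then show "c \<in> A" "verts K - {c} \<subseteq> R" using a(1) V leaves_R by auto
qed

text \<open>Only this direction is stated, because the reverse inequality holds for every star-cycle
  factor. All fibres are non-empty, so \<open>card (leaves a) - 1\<close> is exact subtraction and
  the fibre sizes add up to \<open>card R\<close>.\<close>

lemma star_sum_le:
  assumes le: "\<And>a. a \<in> A \<Longrightarrow> card (leaves a) \<le> t"
  shows "(\<Sum>i=1..t. (i - 1) * star_count F i) + card A \<le> card R"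
proof -
  \<comment> \<open>The factor \<open>i - 1\<close> kills the single-edge components, which may also
    come from two-cycles of \<open>\<pi>\<close>; for larger \<open>i\<close> every star comes from
    a fibre.\<close>
  have count: "(i - 1) * star_count F i \<le> (i - 1) * card {a \<in> A. card (leaves a) = i}" for i
  proof (cases "i \<le> 1")
    case False
    have "star_components F i \<subseteq> (\<lambda>a. induced F (insert a (leaves a))) ` {a \<in> A. card (leaves a) = i}"
    proof
      fix K assume "K \<in> star_components F i"
      then obtain a where "a \<in> A" "K = induced F (insert a (leaves a))" "i = card (leaves a)"
        using False by (cases rule: star_componentE) auto
      then show "K \<in> (\<lambda>a. induced F (insert a (leaves a))) ` {a \<in> A. card (leaves a) = i}"
        by (intro image_eqI[of _ _ a]) simp_all
    qed
    then have "star_count F i \<le> card {a \<in> A. card (leaves a) = i}"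
      unfolding star_count_def using fin(2) by (intro surj_card_le) auto
    then show ?thesis by simp
  qed simp
  have "(\<Sum>i=1..t. (i - 1) * star_count F i) \<le> (\<Sum>i=1..t. (i - 1) * card {a \<in> A. card (leaves a) = i})"
    by (rule sum_mono[OF count])
  also have "\<dots> = (\<Sum>i=1..t. \<Sum>a\<in>{a \<in> A. card (leaves a) = i}. card (leaves a) - 1)"
    by (intro sum.cong refl) simp
  also have "\<dots> = (\<Sum>a\<in>A. card (leaves a) - 1)"
    using fin(2) le star_iso(2) by (intro sum.group) auto
  finally have "(\<Sum>i=1..t. (i - 1) * star_count F i) + card A \<le> (\<Sum>a\<in>A. card (leaves a) - 1) + (\<Sum>a\<in>A. 1)"
    by simp
  also have "\<dots> = (\<Sum>a\<in>A. card (leaves a))"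
    unfolding sum.distrib[symmetric]
    by (intro sum.cong refl) (metis le_add_diff_inverse2 star_iso(2))
  also have "\<dots> = card R"
    unfolding leaves_def using fin g by (intro sum_card_fibres) auto
  finally show ?thesis .
qed

end

section \<open>Determination of \<open>n\<close> and assembly of an optimal factor\<close>

theorem theorem2p5:
  fixes G :: "'a sgraph" and n :: nat and lam :: int and M :: "'a set set"
  assumes "simple_graph G" and "connected_graph G"
    and "\<forall>S\<subseteq>verts G. int (iso_num (delete_verts G S)) \<le> lam * int (card S)"
    and "\<forall>k::int. (\<forall>S\<subseteq>verts G. int (iso_num (delete_verts G S)) \<le> k * int (card S)) \<longrightarrow> lam \<le> k"
    and "maximum_matching G M" and "nc_matching G M = nc G"
    and "fractional_matching_number G = 1 / 2 * (real (card (verts G)) - real n)"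
  shows "lam \<le> \<lceil>real n / real (min_degree G)\<rceil> + 1 \<and>
    nbhd_set G (D_plus G M \<union> D_minus G M) \<subseteq> GE_A G \<and>
    (\<exists>F. is_factor (stars_circuits lam) G F \<and>
         l_number G = (\<Sum>i=1..nat lam. (i - 1) * star_count F i) \<and>
         (\<Sum>i=1..nat lam. (i - 1) * star_count F i) = n \<and>
         (\<forall>j\<ge>1. \<forall>K\<in>star_components F j. K = induced G (verts K)) \<and>
         (\<forall>j\<ge>2. \<forall>K\<in>star_components F j. \<forall>c. is_center K j c \<longrightarrow>
            c \<in> nbhd_set G (D_plus G M \<union> D_minus G M) \<and>
            verts K - {c} \<subseteq> D_plus G M \<union> D_minus G M))"
proof -
  note G = assms(1) and lam = assms(3) and M = assms(5) and frac = assms(7)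
  note m = maximum_matchingD[OF M]
  have V: "verts G \<noteq> {}" using assms(2) unfolding connected_graph_def by blast
  have finV: "finite (verts G)" using G unfolding simple_graph_def by blast
  obtain R where R: "D_minus G M \<subseteq> R" "R \<subseteq> D_plus G M \<union> D_minus G M"
    "R \<subseteq> isolated (induced G (GE_D G))"
    and closed: "\<forall>d a. d \<in> R \<longrightarrow> {d, a} \<in> edges G \<longrightarrow> (\<exists>x\<in>R. {a, x} \<in> M)"
    using alternating_closure[OF G M assms(6)] by blast
  define A where "A = nbhd_set G R"
  define Z where "Z = verts G - R - A"
  obtain \<pi> where \<pi>: "\<pi> permutes Z" "\<forall>z\<in>Z. {z, \<pi> z} \<in> edges G"
    using rest_permutation[OF G M R(1,3) closed] unfolding Z_def A_def by blast
  have RD: "R \<subseteq> GE_D G" and out: "\<And>d a. d \<in> R \<Longrightarrow> {d, a} \<in> edges G \<Longrightarrow> a \<notin> GE_D G"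
    using R(3) isolated_GE_D_iff[OF G] by blast+
  have A_iff: "a \<in> A \<longleftrightarrow> (\<exists>d\<in>R. {d, a} \<in> edges G)" for a
    unfolding A_def nbhd_set_def using mem_nbhd[OF G] by auto
  have AD: "A \<inter> GE_D G = {}" using A_iff out by blast
  have RA: "R \<inter> A = {}" using AD RD by blast
  have RV: "R \<subseteq> verts G" using RD GE_D_subset[of G] by blast
  have AV: "A \<subseteq> verts G" unfolding A_def nbhd_set_def nbhd_def by blast
  have fin: "finite R" "finite A" using RV AV finV finite_subset by blast+
  \<comment> \<open>Used twice: \<open>X = R\<close> gives the deleted set \<open>A\<close> for the
    duality bound, and arbitrary \<open>X\<close> gives Hall's condition with capacities.\<close>
  have subset_isolated: "X \<subseteq> isolated (delete_verts G (\<Union>(nbhd G ` X)))" if "X \<subseteq> R" for X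
  proof
    fix x assume x: "x \<in> X"
    have "x \<notin> nbhd G y" if "y \<in> X" for y
      using out[of y x] that x \<open>X \<subseteq> R\<close> RD mem_nbhd[OF G, of x y] by blast
    then show "x \<in> isolated (delete_verts G (\<Union>(nbhd G ` X)))"
      unfolding isolated_delete_iff[OF G] using x that RV by auto
  qed
  have iso_ge: "card X \<le> iso_num (delete_verts G (\<Union>(nbhd G ` X)))" if "X \<subseteq> R" for X
    unfolding iso_num_def
  proof (rule card_mono)
    show "finite (isolated (delete_verts G (\<Union>(nbhd G ` X))))"
      using finV unfolding isolated_def delete_verts_def induced_def by auto
  qed (rule subset_isolated[OF that])

  have pA: "partner M a \<in> R \<and> {a, partner M a} \<in> M" if "a \<in> A" for a
    using that closed A_iff partner_eqI[OF m] by metis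
  have pR: "partner M r \<in> A \<and> {r, partner M r} \<in> M" if "r \<in> R - D_minus G M" for r
  proof -
    have "r \<in> \<Union>M" using that R(3) unfolding D_minus_def by blast
    then have "{r, partner M r} \<in> M" by (rule partner_edge[OF G m])
    then show ?thesis using A_iff that m unfolding matching_def by blast
  qed
  have p_inv: "partner M (partner M v) = v" if "{v, partner M v} \<in> M" for v
    using partner_eqI[OF m, of "partner M v" v] that by (simp add: insert_commute)
  \<comment> \<open>\<open>M\<close> pairs \<open>A\<close> with the covered vertices of
    \<open>R\<close>: closure gives one inclusion, and the fact that all neighbours of
    \<open>R\<close> are in \<open>A\<close> gives the other.\<close>
  have "partner M ` A = R - D_minus G M"
  proof
    show "partner M ` A \<subseteq> R - D_minus G M" using pA unfolding D_minus_def by blast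
    show "R - D_minus G M \<subseteq> partner M ` A"
    proof
      fix r assume "r \<in> R - D_minus G M"
      then show "r \<in> partner M ` A" using pR[of r] p_inv[of r] by (metis image_eqI)
    qed
  qed
  moreover have injA: "inj_on (partner M) A" using pA p_inv by (metis inj_onI)
  ultimately have "card A = card (R - D_minus G M)" using card_image by metis
  then have card_R: "card R = card A + card (D_minus G M)"
    using R(1) fin(1) by (metis card_Diff_subset card_mono finite_subset le_add_diff_inverse2)

  have deficiency: "iso_num (delete_verts G S) \<le> n + card S" if "S \<subseteq> verts G" for S
  proof -
    have "real (iso_num (delete_verts G S)) \<le> real (n + card S)"
      using fractional_matching_number_upper[OF G that] frac by simp
    then show ?thesis by simp
  qed
  \<comment> \<open>Duality at \<open>S = A\<close>; with \<open>card_R\<close> this says that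
    \<open>D_minus G M\<close> has at most \<open>n\<close> elements.\<close>
  have "card R \<le> n + card A"
    using iso_ge[of R] deficiency[OF AV] unfolding A_def nbhd_set_def by simp
  moreover have "n \<le> card (D_minus G M)"
  proof -
    define Y where "Y = verts G - D_minus G M"
    \<comment> \<open>Moving \<open>Z\<close> by \<open>\<pi>\<close> and exchanging partners
      elsewhere handles every vertex outside \<open>D_minus G M\<close>, giving a fractional
      matching of half that many units.\<close>
    define \<sigma> where "\<sigma> v = (if v \<in> Z then \<pi> v else partner M v)" for v
    have Y_cases: "v \<in> Z \<or> v \<in> A \<or> v \<in> R - D_minus G M" if "v \<in> Y" for v
      using that unfolding Y_def Z_def by blast
    have \<sigma>Z: "\<sigma> v = \<pi> v \<and> \<sigma> v \<in> Z" if "v \<in> Z" for v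
      using that permutes_in_image[OF \<pi>(1)] unfolding \<sigma>_def by simp
    have \<sigma>p: "\<sigma> v = partner M v \<and> \<sigma> v \<notin> Z \<and> {v, partner M v} \<in> M" if "v \<in> Y" "v \<notin> Z" for v
      using Y_cases[OF that(1)] that(2) pA[of v] pR[of v] unfolding \<sigma>_def Z_def by auto
    have "inj_on \<sigma> Y"
    proof (rule inj_onI)
      fix u v assume uv: "u \<in> Y" "v \<in> Y" "\<sigma> u = \<sigma> v"
      consider "u \<in> Z" "v \<in> Z" | "u \<notin> Z" "v \<notin> Z"
        using \<sigma>Z[of u] \<sigma>Z[of v] \<sigma>p[of u] \<sigma>p[of v] uv by metis
      then show "u = v"
      proof cases
        case 1
        then show ?thesis using \<sigma>Z uv(3) permutes_inj[OF \<pi>(1)] by (metis injD)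
      next
        case 2
        then show ?thesis using \<sigma>p uv p_inv by metis
      qed
    qed
    moreover have "{v, \<sigma> v} \<in> edges G" if "v \<in> Y" for v
    proof (cases "v \<in> Z")
      case True
      then show ?thesis using \<sigma>Z \<pi>(2) by simp
    next
      case False
      then have "{v, \<sigma> v} \<in> M" using \<sigma>p[OF that] by simp
      then show ?thesis using m unfolding matching_def by blast
    qed
    ultimately have "real (card Y) \<le> real (card (verts G)) - real n"
      using fractional_matching_number_lower[OF G, of \<sigma> Y] frac by simp
    moreover have "card Y + card (D_minus G M) = card (verts G)"
      unfolding Y_def using R(1) RV finV
      by (metis card_Diff_subset card_mono finite_subset le_add_diff_inverse2 subset_trans)
    ultimately show ?thesis by linarith
  qed
  ultimately have n: "card R = card A + n" using card_R by linarith

  have lam1: "1 \<le> lam" by (rule binding_number_ge_1[OF G V lam])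
  have lam_le: "lam \<le> \<lceil>real n / real (min_degree G)\<rceil> + 1"
    by (rule binding_number_le[OF G V lam assms(4) deficiency])
  define k where "k = nat lam"
  have k: "1 \<le> k" "int k = lam" using lam1 unfolding k_def by auto

  obtain g where assign: "\<And>r. r \<in> R \<Longrightarrow> g r \<in> nbhd G r"
    "\<And>a. a \<in> A \<Longrightarrow> \<exists>r\<in>R. g r = a" "\<And>a. a \<in> A \<Longrightarrow> card {r \<in> R. g r = a} \<le> k"
  \<comment> \<open>\<open>partner M\<close> on \<open>A\<close> is the reversed matching that keeps
    all fibres non-empty, and the capacity \<open>k\<close> comes from applying the definition of
    \<open>lam\<close> to the neighbourhood of \<open>X\<close>.\<close>
  proof (rule assignment_with_bounded_fibres[of R A "nbhd G" k "partner M"])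
    show "nbhd G r \<subseteq> A" if "r \<in> R" for r using that unfolding A_def nbhd_set_def by blast
    show "card X \<le> k * card (\<Union>(nbhd G ` X))" if "X \<subseteq> R" for X
    proof -
      have "\<Union>(nbhd G ` X) \<subseteq> verts G" unfolding nbhd_def by blast
      then have "int (iso_num (delete_verts G (\<Union>(nbhd G ` X)))) \<le> int (k * card (\<Union>(nbhd G ` X)))"
        using lam k(2) by simp
      then show ?thesis using iso_ge[OF that] by linarith
    qed
    show "partner M a \<in> R \<and> a \<in> nbhd G (partner M a)" if "a \<in> A" for a
      using pA[OF that] m mem_nbhd[OF G, of a "partner M a"] unfolding matching_def
      by (auto simp: insert_commute)
  qed (use fin k(1) injA in blast)+

  interpret star_orbit_graph G R A Z g \<pi>
  proof
    show "g r \<in> A \<and> {r, g r} \<in> edges G" if "r \<in> R" for r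
      using assign(1)[OF that] that mem_nbhd[OF G] A_iff by blast
    show "{r, r'} \<notin> edges G" if "r \<in> R" "r' \<in> R" for r r' using out that RD by blast
  qed (use G RV AV RA \<pi> assign(2) in \<open>auto simp: Z_def\<close>)

  have leaves_k: "card (leaves a) \<le> k" if "a \<in> A" for a
    using assign(3)[OF that] unfolding leaves_def .
  have factor: "is_factor (stars_circuits lam) G F"
    using is_factor_F[OF lam1] leaves_k k(2) by force
  \<comment> \<open>Fibres have at most \<open>k\<close> elements, and \<open>1 \<le> k\<close>
    covers the single edges from two-cycles; hence the series for \<open>l_number\<close> stops at
    \<open>k\<close>.\<close>
  have "star_count F i = 0" if "k < i" for i
  proof -
    have "star_components F i = {}"
    proof (rule ccontr)
      assume "star_components F i \<noteq> {}"
      then obtain K where "K \<in> star_components F i" by blast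
      then show False using that k(1) by (cases rule: star_componentE) (auto dest: leaves_k)
    qed
    then show ?thesis unfolding star_count_def by simp
  qed
  then have series: "(\<Sum>i. i * star_count F (Suc i)) = (\<Sum>i=1..k. (i - 1) * star_count F i)"
    by (rule suminf_star_count)
  have star_cycle: "star_cycle_factor G F" using factor lam1 unfolding star_cycle_factor_def by blast
  have lower: "n \<le> (\<Sum>i. i * star_count F' (Suc i))" if "star_cycle_factor G F'" for F'
    using star_cycle_factor_excess[OF G that RV A_def RA] n by simp
  \<comment> \<open>The general lower bound, applied to \<open>F\<close> itself, meets the upper
    bound from the fibre sizes.\<close>
  have sum_n: "(\<Sum>i=1..k. (i - 1) * star_count F i) = n"
    using lower[OF star_cycle] series star_sum_le[of k] leaves_k n by simp
  have l: "l_number G = n"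
    unfolding l_number_def
  proof (rule Least_equality)
    show "\<exists>F'. star_cycle_factor G F' \<and> n = (\<Sum>i. i * star_count F' (Suc i))"
      using star_cycle series sum_n by metis
  qed (use lower in blast)
  have nbhd_A: "nbhd_set G (D_plus G M \<union> D_minus G M) \<subseteq> GE_A G"
  proof
    fix a assume "a \<in> nbhd_set G (D_plus G M \<union> D_minus G M)"
    then obtain d where d: "d \<in> D_plus G M \<union> D_minus G M" "a \<in> nbhd G d"
      unfolding nbhd_set_def by blast
    then have "d \<in> isolated (induced G (GE_D G))" unfolding D_plus_def D_minus_def by blast
    then show "a \<in> GE_A G"
      using d(2) mem_nbhd[OF G] isolated_GE_D_iff[OF G] unfolding GE_A_def nbhd_set_def by blast
  qed
  have A_sub: "A \<subseteq> nbhd_set G (D_plus G M \<union> D_minus G M)"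
    using R(2) unfolding A_def nbhd_set_def by blast
  show ?thesis
  proof (intro conjI exI[of _ F] allI impI ballI)
    show "K = induced G (verts K)" if "K \<in> star_components F j" for j K
      using that by (rule star_component_induced)
    show "c \<in> nbhd_set G (D_plus G M \<union> D_minus G M)"
      and "verts K - {c} \<subseteq> D_plus G M \<union> D_minus G M"
      if "2 \<le> j" "K \<in> star_components F j" "is_center K j c" for j K c
      using star_component_center[OF that(2,1,3)] A_sub R(2) by blast+
  qed (use lam_le nbhd_A factor l sum_n in \<open>simp_all add: k_def\<close>)
qed

end
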